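(* Let $f:\mathbb R^{m\times n}\to\mathbb R$ be differentiable, with $m\ge n$, and assume: (1) $f(\mathbf X)\ge f^\star>-\infty$ for all $\mathbf X$; (2) $\|\nabla f(\mathbf Y)-\nabla f(\mathbf X)\|_F\le L\|\mathbf Y-\mathbf X\|_F$ for all $\mathbf X,\mathbf Y$, where $L>0$; (3) there is $\sigma>0$ such that for all $\mathbf X$, $\mathbb E[\nabla f(\mathbf X;\xi)]=\nabla f(\mathbf X)$ and $\mathbb E\|\nabla f(\mathbf X;\xi)-\nabla f(\mathbf X)\|_F^2\le\sigma^2$. Let $\eta_t=t^{-3/4}$, $\beta_t=1-t^{-1/2}$, $a:=0.2\sqrt{\max\{m,n\}}$, and let the iterates be generated, for $t\ge1$, from $\mathbf M_0=\mathbf 0$ and an initial point $\mathbf X_1$ by $$\mathbf G_t=\nabla f(\mathbf X_t;\xi_t),\quad \mathbf M_t=\beta_t\mathbf M_{t-1}+(1-\beta_t)\mathbf G_t,\quad \hat{\mathbf M}_t=(\mathbf D_{r,t}^{1/2})^\dagger\mathbf M_t,\quad \mathbf O_t=\operatorname{Orth}(\hat{\mathbf M}_t),$$ $$\mathbf X_{t+1}=(1-\lambda_t\eta_t)\mathbf X_t-a\eta_t\mathbf O_t,\qquad \mathbf D_{r,t}=\operatorname{diag}\bigl(\operatorname{rowsum}(\mathbf M_t\odot\mathbf M_t)\bigr),$$ where $$0\le\rho<\frac{a}{\sqrt m},\qquad 0\le\lambda_t\le\frac{\rho}{\|\mathbf X_1\|_F+4a\sqrt n}\,t^{-1/4}.$$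 Then, for every $T\ge1$, $$\frac1T\sum_{t=1}^T\mathbb E\|\nabla f(\mathbf X_t)\|_F\le\frac{f(\mathbf X_1)-f^\star+C_{1,\rho}(1+\ln T)+C_{2,\rho}}{(a/\sqrt m-\rho)\,T^{1/4}},$$ where $$C_{1,\rho}=\frac aL\Bigl(2\sqrt2\,L^2(a\sqrt n+\rho)^2+\sigma^2\Bigr)+aL\Bigl(\frac1{\sqrt m}+\sqrt n\Bigr)^2,\qquad C_{2,\rho}=\frac{a\sigma^2}{L}+\frac{3L}{2}(a\sqrt n+\rho)^2.$$
   Context: $f(\mathbf X)=\mathbb E_{\xi\sim\mathcal D}[f(\mathbf X;\xi)]$ is a possibly nonconvex stochastic objective; $\xi_1,\xi_2,\dots$ are i.i.d. samples from $\mathcal D$ ($\xi_t$ is independent of $\mathbf X_1,\dots,\mathbf X_t$ and $\mathbf M_{t-1}$), $\mathbf X_1$ is deterministic, and $\rho$ and $(\lambda_t)$ are deterministic. For a nonzero matrix with compact SVD $\mathbf A=\mathbf U\Sigma\mathbf V^\top$, $\operatorname{Orth}(\mathbf A):=\mathbf U\mathbf V^\top$; $\operatorname{Orth}(\mathbf 0):=\mathbf 0$. $\odot$ is the entrywise product, $\operatorname{rowsum}(\mathbf A)\in\mathbb R^m$ the vector of row sums, $^\dagger$ the Moore–Penrose pseudoinverse (so $\hat{\mathbf M}_t$ is $\mathbf M_t$ with each nonzero row scaled to unit Euclidean norm and zero rows left unchanged), and $\|\cdot\|_F$ the Frobenius norm. *)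

theory Defs
  imports "HOL-Probability.Probability"
begin

text \<open>
  A real \<open>m\<close> by \<open>n\<close> matrix is an element of \<^typ>\<open>real^'n^'m\<close>.  On this type the library's
  \<^const>\<open>norm\<close> is the Frobenius norm, \<open>\<bullet>\<close> is the Frobenius inner product, \<open>*\<close> is the entrywise
  product and \<open>**\<close> is the matrix product.  Consequently \<open>GDERIV f X :> G\<close> says that \<open>f\<close> is
  (Frechet) differentiable at \<open>X\<close> with gradient matrix \<open>G\<close>.
\<close>

definition rowsum :: "real^'n^'m \<Rightarrow> real^'m" where
  "rowsum A = (\<chi> i. \<Sum>j\<in>UNIV. A $ i $ j)"

definition diag_mat :: "real^'m \<Rightarrow> real^'m^'m" where
  "diag_mat v = (\<chi> i j. if i = j then v $ i else 0)"

definition pos_semidef :: "real^'m^'m \<Rightarrow> bool" where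
  "pos_semidef A \<longleftrightarrow> transpose A = A \<and> (\<forall>x. 0 \<le> x \<bullet> (A *v x))"

text \<open>The principal square root; only meaningful for positive semidefinite arguments.\<close>

definition mat_sqrt :: "real^'m^'m \<Rightarrow> real^'m^'m" where
  "mat_sqrt A = (THE B. pos_semidef B \<and> B ** B = A)"

text \<open>The Moore--Penrose pseudoinverse, through the four Penrose conditions.\<close>

definition is_pinv :: "real^'n^'m \<Rightarrow> real^'m^'n \<Rightarrow> bool" where
  "is_pinv A P \<longleftrightarrow>
     A ** P ** A = A \<and> P ** A ** P = P \<and>
     transpose (A ** P) = A ** P \<and> transpose (P ** A) = P ** A"

definition pinv :: "real^'n^'m \<Rightarrow> real^'m^'n" where
  "pinv A = (THE P. is_pinv A P)"

text \<open>
  The number \<open>r\<close> of columns of the factors in a compact SVD \<open>A = U \<Sigma> V\<^sup>T\<close> is the rank of \<open>A\<close>, which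
  is not a type.  The factors are therefore given by their columns \<open>u 0, \<dots>, u (r - 1)\<close> and
  \<open>v 0, \<dots>, v (r - 1)\<close>, and \<open>\<Sigma>\<close> by its diagonal entries \<open>s 0, \<dots>, s (r - 1)\<close>.  The singular values
  are not required to be sorted.
\<close>

definition orthonormal_columns :: "nat \<Rightarrow> (nat \<Rightarrow> real^'m) \<Rightarrow> bool" where
  "orthonormal_columns r u \<longleftrightarrow> (\<forall>k<r. \<forall>l<r. u k \<bullet> u l = (if k = l then 1 else 0))"

definition compact_svd ::
  "real^'n^'m \<Rightarrow> nat \<Rightarrow> (nat \<Rightarrow> real^'m) \<Rightarrow> (nat \<Rightarrow> real) \<Rightarrow> (nat \<Rightarrow> real^'n) \<Rightarrow> bool" where
  "compact_svd A r u s v \<longleftrightarrow>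
     orthonormal_columns r u \<and> orthonormal_columns r v \<and> (\<forall>k<r. 0 < s k) \<and>
     A = (\<chi> i j. \<Sum>k<r. u k $ i * s k * v k $ j)"

text \<open>\<open>Orth A = U V\<^sup>T\<close>; the product does not depend on the choice of the compact SVD.\<close>

definition Orth :: "real^'n^'m \<Rightarrow> real^'n^'m" where
  "Orth A = (if A = 0 then 0 else
     (THE Q. \<exists>r u s v. compact_svd A r u s v \<and> Q = (\<chi> i j. \<Sum>k<r. u k $ i * v k $ j)))"

definition row_normalize :: "real^'n^'m \<Rightarrow> real^'n^'m" where
  "row_normalize A = pinv (mat_sqrt (diag_mat (rowsum (A * A)))) ** A"

end

theory Submission
  imports Defs
begin

text \<open>
  With \<open>K = a \<surd>n + \<rho>\<close>, the weight decay bound keeps \<open>\<lambda>\<^sub>t \<parallel>X\<^sub>t\<parallel> \<le> \<rho>\<close>, so each step has length at most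
  \<open>\<eta>\<^sub>t K\<close>. The direction satisfies \<open>\<parallel>O\<^sub>t\<parallel> \<le> \<surd>n\<close> and \<open>\<langle>M\<^sub>t, O\<^sub>t\<rangle> \<ge> \<parallel>M\<^sub>t\<parallel> / \<surd>m\<close>: a row-normalized matrix has
  singular values at most \<open>\<surd>m\<close>, so the diagonal of its polar factor \<open>U \<Sigma> U\<^sup>T\<close> is at least \<open>1 / \<surd>m\<close> at
  every nonzero row. Hence \<open>f\<close> decreases by \<open>(a / \<surd>m - \<rho>) \<eta>\<^sub>t \<parallel>\<nabla>f(X\<^sub>t)\<parallel>\<close> up to \<open>L \<eta>\<^sub>t\<^sup>2 K\<^sup>2 / 2\<close> and a multiple
  of \<open>\<eta>\<^sub>t \<parallel>M\<^sub>t - \<nabla>f(X\<^sub>t)\<parallel>\<close>. The mean square \<open>e\<^sub>t\<close> of this momentum error obeys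
  \<open>e\<^sub>t \<le> (1 - t\<^bsup>-1/2\<^esup>) e\<^bsub>t-1\<^esub> + t\<^bsup>1/2\<^esup> L\<^sup>2 K\<^sup>2 \<eta>\<^bsub>t-1\<^esub>\<^sup>2 + \<sigma>\<^sup>2 / t\<close>, which telescopes to \<open>\<Sum> e\<^sub>t / \<surd>t = O(ln T)\<close>;
  Young's inequality then converts the first-order error into this weighted sum.
\<close>

section \<open>Singular value decomposition and the polar factor\<close>

text \<open>A nonnegative quadratic that vanishes at the origin has slope zero there. This extracts
  first-order conditions from maximality and from semidefiniteness.\<close>

lemma eq_zero_if_linear_le_quadratic:
  fixes p q :: real
  assumes "\<And>t. 2 * t * p \<le> t\<^sup>2 * q"
  shows "p = 0"
proof (rule ccontr)
  assume "p \<noteq> 0"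
  \<comment> \<open>\<open>c\<close> is positive and exceeds \<open>q\<close>, so at
    \<open>t = p / c\<close> the hypothesis would force
    \<open>2 * p^2 / c \<le> p^2 / c\<close>.\<close>
  define c where "c = \<bar>q\<bar> + 1"
  have c: "c > 0" "q < c" by (auto simp: c_def)
  have "2 * (p / c) * p \<le> (p / c)\<^sup>2 * q" by (rule assms)
  also have "\<dots> \<le> (p / c)\<^sup>2 * c" using c by (intro mult_left_mono) auto
  also have "\<dots> = (p / c) * p" using c by (simp add: power2_eq_square)
  finally have "(p / c) * p \<le> 0" by simp
  moreover have "(p / c) * p > 0"
    using not_real_square_gt_zero[of p] \<open>p \<noteq> 0\<close> c by (metis divide_pos_pos times_divide_eq_left)
  ultimately show False by simp
qed

lemma norm_add_scaleR_sq:
  fixes x y :: "'a::real_inner"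
  shows "(norm (x + t *\<^sub>R y))\<^sup>2 = (norm x)\<^sup>2 + 2 * t * (x \<bullet> y) + t\<^sup>2 * (norm y)\<^sup>2"
  unfolding power2_norm_eq_inner
  by (simp add: inner_add_left inner_add_right inner_commute power2_eq_square algebra_simps)

text \<open>A unit vector of \<open>S\<close> on which \<open>h\<close> is longest is orthogonal, after applying \<open>h\<close>, to every
  vector of \<open>S\<close> orthogonal to it; deflating by it repeatedly yields right singular vectors.\<close>

lemma linear_top_singular_vector:
  fixes h :: "'a::euclidean_space \<Rightarrow> 'b::euclidean_space"
  assumes h: "linear h" and S: "subspace S" and nz: "\<exists>x\<in>S. h x \<noteq> 0"
  obtains v where "v \<in> S" "norm v = 1" "h v \<noteq> 0"
    "\<And>w. w \<in> S \<Longrightarrow> v \<bullet> w = 0 \<Longrightarrow> h v \<bullet> h w = 0"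
proof -
  interpret h: linear h by fact
  obtain x where x: "x \<in> S" "h x \<noteq> 0" using nz by auto
  have x0: "x \<noteq> 0" using x h.zero by auto
  \<comment> \<open>The unit sphere of \<open>S\<close> is compact; homogeneity of \<open>h\<close>
    extends the maximum attained there to the bound \<open>max\<close> on all of
    \<open>S\<close>.\<close>
  define K where "K = S \<inter> sphere 0 1"
  have "compact K"
    unfolding K_def by (intro closed_Int_compact closed_subspace S compact_sphere)
  moreover have xK: "(1 / norm x) *\<^sub>R x \<in> K"
    using x x0 S by (auto simp: K_def subspace_scale)
  moreover have "continuous_on K (\<lambda>x. norm (h x))"
    using h by (intro continuous_intros linear_continuous_on_compose[OF continuous_on_id, simplified]) auto
  ultimately obtain v where v: "v \<in> K" "\<And>y. y \<in> K \<Longrightarrow> norm (h y) \<le> norm (h v)"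
    using continuous_attains_sup[of K "\<lambda>x. norm (h x)"] by auto
  have vS: "v \<in> S" "norm v = 1" using v by (auto simp: K_def)
  have "0 < norm (h ((1 / norm x) *\<^sub>R x))" using x x0 by (simp add: h.scaleR)
  also have "\<dots> \<le> norm (h v)" using v xK by blast
  finally have hv: "h v \<noteq> 0" by auto
  have max: "norm (h y) \<le> norm (h v) * norm y" if "y \<in> S" for y
  proof (cases "y = 0")
    case False
    have "norm (h ((1 / norm y) *\<^sub>R y)) \<le> norm (h v)"
      using that False S by (intro v) (auto simp: K_def subspace_scale)
    then show ?thesis using False by (simp add: h.scaleR field_simps)
  qed (simp add: h.zero)
  \<comment> \<open>Along \<open>v + t w\<close> both sides of the squared bound are quadratic in
    \<open>t\<close> with the same value at \<open>t = 0\<close>, so the linear term must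
    vanish.\<close>
  have "h v \<bullet> h w = 0" if w: "w \<in> S" "v \<bullet> w = 0" for w
  proof (rule eq_zero_if_linear_le_quadratic)
    fix t :: real
    have "v + t *\<^sub>R w \<in> S" using w vS S by (auto intro!: subspace_add subspace_scale)
    from max[OF this] have "(norm (h (v + t *\<^sub>R w)))\<^sup>2 \<le> (norm (h v))\<^sup>2 * (norm (v + t *\<^sub>R w))\<^sup>2"
      by (metis norm_ge_zero power_mono power_mult_distrib)
    moreover have "(norm (h (v + t *\<^sub>R w)))\<^sup>2
        = (norm (h v))\<^sup>2 + 2 * t * (h v \<bullet> h w) + t\<^sup>2 * (norm (h w))\<^sup>2"
      by (simp add: h.add h.scaleR norm_add_scaleR_sq)
    moreover have "(norm (v + t *\<^sub>R w))\<^sup>2 = 1 + t\<^sup>2 * (norm w)\<^sup>2"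
      using w vS by (simp add: norm_add_scaleR_sq)
    ultimately show "2 * t * (h v \<bullet> h w) \<le> t\<^sup>2 * ((norm (h v))\<^sup>2 * (norm w)\<^sup>2 - (norm (h w))\<^sup>2)"
      by (simp add: algebra_simps)
  qed
  then show ?thesis using that vS hv by blast
qed

text \<open>Induction on \<open>dim S\<close>: a top singular vector is split off and its orthogonal
  complement within \<open>S\<close> is treated next. The induction stops as soon as
  \<open>h\<close> vanishes on what is left, so \<open>r\<close> is the rank of \<open>h\<close> on
  \<open>S\<close>.\<close>

lemma linear_singular_vectors:
  fixes h :: "real^'n \<Rightarrow> 'b::euclidean_space"
  assumes h: "linear h" and "subspace S"
  shows "\<exists>r v. orthonormal_columns r v \<and> (\<forall>k<r. v k \<in> S \<and> h (v k) \<noteq> 0) \<and>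
    (\<forall>k<r. \<forall>l<r. k \<noteq> l \<longrightarrow> h (v k) \<bullet> h (v l) = 0) \<and>
    (\<forall>x\<in>S. h x = (\<Sum>k<r. (v k \<bullet> x) *\<^sub>R h (v k)))"
  using \<open>subspace S\<close>
proof (induction "dim S" arbitrary: S rule: less_induct)
  case less
  interpret h: linear h by fact
  show ?case
  proof (cases "\<exists>x\<in>S. h x \<noteq> 0")
    case False
    then show ?thesis by (intro exI[of _ 0]) (auto simp: orthonormal_columns_def)
  next
    case True
    then obtain w where w: "w \<in> S" "norm w = 1" "h w \<noteq> 0"
      and orth: "\<And>y. y \<in> S \<Longrightarrow> w \<bullet> y = 0 \<Longrightarrow> h w \<bullet> h y = 0"
      using linear_top_singular_vector[OF h \<open>subspace S\<close>] by metis
    define S' where "S' = S \<inter> {x. w \<bullet> x = 0}"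
    have S': "subspace S'"
      unfolding S'_def using less.prems by (intro subspace_inter subspace_hyperplane)
    have ww: "w \<bullet> w = 1" using w by (simp add: norm_eq_1)
    have "S' \<subset> S" using w ww unfolding S'_def by (force simp: psubset_eq)
    then have "dim S' < dim S"
      using S' less.prems by (intro dim_psubset) (simp add: span_eq_iff[THEN iffD2])
    from less.hyps[OF this S'] obtain r v where v1: "orthonormal_columns r v"
      and v2: "\<forall>k<r. v k \<in> S' \<and> h (v k) \<noteq> 0"
      and v3: "\<forall>k<r. \<forall>l<r. k \<noteq> l \<longrightarrow> h (v k) \<bullet> h (v l) = 0"
      and v4: "\<forall>x\<in>S'. h x = (\<Sum>k<r. (v k \<bullet> x) *\<^sub>R h (v k))"
      by (elim exE conjE) (rule that)
    have vw: "w \<bullet> v k = 0" "v k \<bullet> w = 0" "h w \<bullet> h (v k) = 0" "h (v k) \<bullet> h w = 0" "v k \<in> S"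
      if "k < r" for k
      using v2[rule_format, OF that] orth[of "v k"] by (auto simp: S'_def inner_commute)
    define v' where "v' = v(r := w)"
    have v': "v' r = w" "\<And>k. k < r \<Longrightarrow> v' k = v k" by (auto simp: v'_def)
    show ?thesis
    proof (intro exI[of _ "Suc r"] exI[of _ v'] conjI ballI)
      show "orthonormal_columns (Suc r) v'"
        using v1 vw ww by (auto simp: orthonormal_columns_def less_Suc_eq v')
      show "\<forall>k<Suc r. v' k \<in> S \<and> h (v' k) \<noteq> 0"
        using vw v2 w by (auto simp: less_Suc_eq v')
      show "\<forall>k<Suc r. \<forall>l<Suc r. k \<noteq> l \<longrightarrow> h (v' k) \<bullet> h (v' l) = 0"
        using vw v3 by (auto simp: less_Suc_eq v')
      fix x assume x: "x \<in> S"
      \<comment> \<open>Removing the \<open>w\<close> component lands in \<open>S'\<close>; the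
        coefficients are unchanged because every \<open>v k\<close> is orthogonal to
        \<open>w\<close>.\<close>
      define y where "y = x - (w \<bullet> x) *\<^sub>R w"
      have "y \<in> S'"
        using x w ww less.prems
        by (auto simp: S'_def y_def inner_diff_right intro!: subspace_diff subspace_scale)
      then have "h y = (\<Sum>k<r. (v k \<bullet> y) *\<^sub>R h (v k))" by (rule v4[rule_format])
      also have "\<dots> = (\<Sum>k<r. (v k \<bullet> x) *\<^sub>R h (v k))"
        by (intro sum.cong) (auto simp: y_def inner_diff_right vw)
      finally have "h x = (\<Sum>k<r. (v k \<bullet> x) *\<^sub>R h (v k)) + (w \<bullet> x) *\<^sub>R h w"
        by (simp add: y_def h.diff h.scaleR algebra_simps)
      then show "h x = (\<Sum>k<Suc r. (v' k \<bullet> x) *\<^sub>R h (v' k))" by (simp add: v')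
    qed
  qed
qed

text \<open>The weights \<open>s\<close> may be arbitrary reals, unlike in
  \<open>compact_svd\<close>. With the factors fixed, linear combinations, Gram cubes and limits act
  on the weights alone, and the constant weight 1 gives the polar factor.\<close>

definition svd_prod :: "nat \<Rightarrow> (nat \<Rightarrow> real^'m) \<Rightarrow> (nat \<Rightarrow> real) \<Rightarrow> (nat \<Rightarrow> real^'n) \<Rightarrow> real^'n^'m"
  where "svd_prod r u s v = (\<chi> i j. \<Sum>k<r. u k $ i * s k * v k $ j)"

text \<open>The images \<open>A *v v k\<close> of the right singular vectors are nonzero and
  pairwise orthogonal: their lengths are the singular values and their directions the left singular
  vectors.\<close>

lemma compact_svd_exists: "\<exists>r u s v. compact_svd (A :: real^'n^'m) r u s v"
proof -
  obtain r v where v_on: "orthonormal_columns r v" and v_nz: "\<forall>k<r. v k \<in> UNIV \<and> A *v v k \<noteq> 0"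
    and v_orth: "\<forall>k<r. \<forall>l<r. k \<noteq> l \<longrightarrow> (A *v v k) \<bullet> (A *v v l) = 0"
    and v_sum: "\<forall>x\<in>UNIV. A *v x = (\<Sum>k<r. (v k \<bullet> x) *\<^sub>R (A *v v k))"
    using linear_singular_vectors[OF matrix_vector_mul_linear[of A] subspace_UNIV]
    by (elim exE conjE) (rule that)
  define s where "s k = norm (A *v v k)" for k
  define u where "u k = (1 / s k) *\<^sub>R (A *v v k)" for k
  have s: "0 < s k" if "k < r" for k using v_nz that by (simp add: s_def)
  have us: "(A *v v k) $ i = u k $ i * s k" if "k < r" for k i
    using s[OF that] by (simp add: u_def)
  have "orthonormal_columns r u"
    unfolding orthonormal_columns_def
  proof (intro allI impI)
    fix k l assume kl: "k < r" "l < r"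
    show "u k \<bullet> u l = (if k = l then 1 else 0)"
      using kl v_orth s[of k]
      by (auto simp: u_def) (simp add: s_def dot_square_norm power2_eq_square)
  qed
  moreover have "A = (\<chi> i j. \<Sum>k<r. u k $ i * s k * v k $ j)"
  proof -
    have "A $ i $ j = (\<Sum>k<r. u k $ i * s k * v k $ j)" for i j
    proof -
      have "A $ i $ j = (A *v axis j 1) $ i"
        by (simp add: matrix_vector_mul_component inner_axis)
      also have "\<dots> = (\<Sum>k<r. v k $ j * (A *v v k) $ i)"
        by (subst v_sum[rule_format]) (simp_all add: inner_axis)
      also have "\<dots> = (\<Sum>k<r. u k $ i * s k * v k $ j)"
        by (intro sum.cong) (auto simp: us)
      finally show ?thesis .
    qed
    then show ?thesis by (simp add: vec_eq_iff)
  qed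
  ultimately show ?thesis using v_on s unfolding compact_svd_def by blast
qed

lemma svd_prod_mult_vec:
  "svd_prod r u s v *v x = (\<Sum>k<r. (s k * (v k \<bullet> x)) *\<^sub>R u k)"
proof -
  have "(\<Sum>j\<in>UNIV. (\<Sum>k<r. u k $ i * s k * v k $ j) * x $ j)
     = (\<Sum>k<r. s k * (v k \<bullet> x) * u k $ i)" for i
    by (simp add: sum_distrib_right sum_distrib_left inner_vec_def
        sum.swap[of _ "UNIV" "{..<r}"] mult_ac)
  then show ?thesis
    by (simp add: vec_eq_iff svd_prod_def matrix_vector_mult_def)
qed

lemma transpose_svd_prod: "transpose (svd_prod r u s v) = svd_prod r v s u"
  by (simp add: transpose_def svd_prod_def vec_eq_iff mult_ac)

lemma svd_prod_row:
  "svd_prod r u s v $ i = (\<Sum>k<r. (u k $ i * s k) *\<^sub>R v k)"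
  by (simp add: vec_eq_iff svd_prod_def)

lemma svd_prod_mult_sum:
  assumes "orthonormal_columns r v"
  shows "svd_prod r u s v *v (\<Sum>l<r. c l *\<^sub>R v l) = (\<Sum>k<r. (s k * c k) *\<^sub>R u k)"
proof -
  have "v k \<bullet> (\<Sum>l<r. c l *\<^sub>R v l) = c k" if "k < r" for k
  proof -
    have "v k \<bullet> (\<Sum>l<r. c l *\<^sub>R v l) = (\<Sum>l<r. if k = l then c l else 0)"
      unfolding inner_sum_right
      by (intro sum.cong) (use that assms in \<open>auto simp: orthonormal_columns_def\<close>)
    then show ?thesis using that by simp
  qed
  then show ?thesis by (simp add: svd_prod_mult_vec)
qed

lemma svd_prod_gram:
  assumes "orthonormal_columns r u" "orthonormal_columns r v"
  shows "svd_prod r u s v ** transpose (svd_prod r u s v) ** svd_prod r u s v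
    = svd_prod r u (\<lambda>k. s k ^ 3) v"
  unfolding matrix_eq transpose_svd_prod matrix_vector_mul_assoc[symmetric]
proof
  fix x
  have "svd_prod r u s v *v (svd_prod r v s u *v (svd_prod r u s v *v x))
    = svd_prod r u s v *v (svd_prod r v s u *v (\<Sum>k<r. (s k * (v k \<bullet> x)) *\<^sub>R u k))"
    by (simp only: svd_prod_mult_vec)
  also have "\<dots> = svd_prod r u (\<lambda>k. s k ^ 3) v *v x"
    by (simp only: svd_prod_mult_sum assms) (simp add: svd_prod_mult_vec power3_eq_cube mult.assoc)
  finally show "svd_prod r u s v *v (svd_prod r v s u *v (svd_prod r u s v *v x))
    = svd_prod r u (\<lambda>k. s k ^ 3) v *v x" .
qed

text \<open>This is the \<open>i\<close>-th diagonal entry of \<open>U diag(s t) U^T\<close>; for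
  \<open>t = 1\<close> it belongs to the positive semidefinite polar factor.\<close>

lemma svd_prod_inner_rows:
  assumes "orthonormal_columns r v"
  shows "svd_prod r u s v $ i \<bullet> svd_prod r u t v $ i = (\<Sum>k<r. s k * t k * (u k $ i)\<^sup>2)"
proof -
  have "svd_prod r u s v $ i \<bullet> svd_prod r u t v $ i
    = (\<Sum>k<r. \<Sum>l<r. if k = l then (u k $ i * s k) * (u l $ i * t l) else 0)"
    unfolding svd_prod_row inner_sum_left
    unfolding inner_sum_right
    by (intro sum.cong) (use assms in \<open>auto simp: orthonormal_columns_def\<close>)
  also have "\<dots> = (\<Sum>k<r. s k * t k * (u k $ i)\<^sup>2)"
    by (intro sum.cong) (auto simp: power2_eq_square mult_ac)
  finally show ?thesis .
qed

lemma svd_prod_inner: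
  assumes "orthonormal_columns r u" "orthonormal_columns r v"
  shows "svd_prod r u s v \<bullet> svd_prod r u t v = (\<Sum>k<r. s k * t k)"
proof -
  have "svd_prod r u s v \<bullet> svd_prod r u t v = (\<Sum>i\<in>UNIV. \<Sum>k<r. s k * t k * (u k $ i)\<^sup>2)"
    by (subst inner_vec_def) (simp add: svd_prod_inner_rows assms)
  also have "\<dots> = (\<Sum>k<r. s k * t k * (u k \<bullet> u k))"
    by (subst sum.swap) (simp add: inner_vec_def power2_eq_square sum_distrib_left mult_ac)
  also have "\<dots> = (\<Sum>k<r. s k * t k)"
    by (intro sum.cong) (use assms in \<open>auto simp: orthonormal_columns_def\<close>)
  finally show ?thesis .
qed

lemma norm_svd_prod:
  assumes "orthonormal_columns r u" "orthonormal_columns r v"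
  shows "(norm (svd_prod r u s v))\<^sup>2 = (\<Sum>k<r. (s k)\<^sup>2)"
  unfolding power2_norm_eq_inner by (simp add: svd_prod_inner[OF assms] power2_eq_square)

text \<open>The Frobenius norm dominates the spectral norm, which is enough to scale all singular
  values into \<open>(0, 1]\<close>.\<close>

lemma singular_value_le_norm:
  assumes "orthonormal_columns r u" "orthonormal_columns r v" "k < r"
  shows "s k \<le> norm (svd_prod r u s v)"
proof -
  have "(s k)\<^sup>2 \<le> (\<Sum>k<r. (s k)\<^sup>2)" using \<open>k < r\<close> by (intro member_le_sum) auto
  then show ?thesis
    using norm_svd_prod[OF assms(1,2), of s] by (metis power2_le_imp_le norm_ge_zero)
qed

lemma svd_prod_linear:
  "c *\<^sub>R svd_prod r u s v = svd_prod r u (\<lambda>k. c * s k) v"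
  "svd_prod r u s v - svd_prod r u t v = svd_prod r u (\<lambda>k. s k - t k) v"
  by (simp_all add: svd_prod_def vec_eq_iff sum_distrib_left sum_subtractf[symmetric] algebra_simps)

lemma tendsto_svd_prod:
  assumes "\<And>k. k < r \<Longrightarrow> (\<lambda>j. s j k) \<longlonglongrightarrow> t k"
  shows "(\<lambda>j. svd_prod r u (s j) v) \<longlonglongrightarrow> svd_prod r u t v"
  unfolding svd_prod_def by (intro tendsto_vec_lambda tendsto_intros) (use assms in auto)

text \<open>The Newton--Schulz iteration drives every singular value in \<open>(0, 1]\<close> to \<open>1\<close>. It exhibits
  \<^const>\<open>Orth\<close> as a limit of continuous maps, so it yields both the independence of the chosen
  SVD and Borel measurability.\<close>

definition newton_schulz :: "real^'n^'m \<Rightarrow> real^'n^'m" where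
  "newton_schulz A = (3/2) *\<^sub>R A - (1/2) *\<^sub>R (A ** transpose A ** A)"

definition newton_schulz_scalar :: "real \<Rightarrow> real" where
  "newton_schulz_scalar x = (3/2) * x - (1/2) * x ^ 3"

lemma newton_schulz_funpow_svd_prod:
  assumes "orthonormal_columns r u" "orthonormal_columns r v"
  shows "(newton_schulz ^^ j) (svd_prod r u s v)
    = svd_prod r u (\<lambda>k. (newton_schulz_scalar ^^ j) (s k)) v"
  by (induction j)
    (simp_all add: newton_schulz_def svd_prod_gram[OF assms] svd_prod_linear newton_schulz_scalar_def)

text \<open>The error satisfies \<open>1 - g x = (1 - x)^2 * (2 + x) / 2\<close>, and the iterates
  never fall below \<open>s\<close>, so each step shrinks it at least by the factor
  \<open>1 - s/2\<close>.\<close>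

lemma newton_schulz_scalar_LIMSEQ:
  assumes "0 < s" "s \<le> 1"
  shows "(\<lambda>j. (newton_schulz_scalar ^^ j) s) \<longlonglongrightarrow> 1"
proof -
  define g where "g = newton_schulz_scalar"
  have step: "x \<le> g x \<and> g x \<le> 1 \<and> 1 - g x \<le> (1 - s/2) * (1 - x)" if "s \<le> x" "x \<le> 1" for x
  proof -
    have e1: "g x - x = x * (1 - x) * (1 + x) / 2"
      by (simp add: g_def newton_schulz_scalar_def field_simps power3_eq_cube)
    have e2: "1 - g x = (1 - x) * ((1 - x) * (2 + x) / 2)"
      by (simp add: g_def newton_schulz_scalar_def field_simps power3_eq_cube)
    have "(1 - x) * (2 + x) / 2 \<le> 1 - x / 2"
      by (simp add: field_simps)
    also have "\<dots> \<le> 1 - s/2" using that by simp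
    finally have "(1 - x) * ((1 - x) * (2 + x) / 2) \<le> (1 - x) * (1 - s/2)"
      using that by (intro mult_left_mono) auto
    moreover have "0 \<le> x * (1 - x) * (1 + x) / 2" "0 \<le> (1 - x) * ((1 - x) * (2 + x) / 2)"
      using that assms by auto
    ultimately show ?thesis using e1 e2 by (auto simp: mult.commute)
  qed
  have inv: "s \<le> (g ^^ j) s \<and> (g ^^ j) s \<le> 1 \<and> 1 - (g ^^ j) s \<le> (1 - s/2) ^ j" for j
  proof (induction j)
    case (Suc j)
    have "1 - (g ^^ Suc j) s \<le> (1 - s/2) * (1 - (g ^^ j) s)" using step Suc by auto
    also have "\<dots> \<le> (1 - s/2) * (1 - s/2) ^ j" using Suc assms by (intro mult_left_mono) auto
    finally show ?case using step[of "(g ^^ j) s"] Suc by auto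
  qed (use assms in auto)
  have "(\<lambda>j. (1 - s/2) ^ j) \<longlonglongrightarrow> 0" using assms by (intro LIMSEQ_realpow_zero) auto
  then have "(\<lambda>j. 1 - (g ^^ j) s) \<longlonglongrightarrow> 0"
    by (rule tendsto_sandwich[OF _ _ tendsto_const, rotated -1]) (use inv in auto)
  from tendsto_diff[OF tendsto_const[of 1] this] show ?thesis by (simp add: g_def)
qed

lemma compact_svd_iff_svd_prod:
  "compact_svd A r u s v \<longleftrightarrow> orthonormal_columns r u \<and> orthonormal_columns r v \<and>
     (\<forall>k<r. 0 < s k) \<and> A = svd_prod r u s v"
  by (simp add: compact_svd_def svd_prod_def)

text \<open>Dividing by the Frobenius norm brings the singular values into \<open>(0, 1]\<close>.
  The sequence depends on \<open>A\<close> only, so its limit cannot depend on the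
  decomposition.\<close>

lemma compact_svd_LIMSEQ:
  assumes "compact_svd A r u s v"
  shows "(\<lambda>j. (newton_schulz ^^ j) (inverse (norm A) *\<^sub>R A)) \<longlonglongrightarrow> svd_prod r u (\<lambda>_. 1) v"
proof -
  have o: "orthonormal_columns r u" "orthonormal_columns r v"
    and s: "\<And>k. k < r \<Longrightarrow> 0 < s k" and A: "A = svd_prod r u s v"
    using assms by (auto simp: compact_svd_iff_svd_prod)
  have le: "s k \<le> norm A" if "k < r" for k
    using singular_value_le_norm[OF o that] A by simp
  have "(\<lambda>j. (newton_schulz_scalar ^^ j) (inverse (norm A) * s k)) \<longlonglongrightarrow> 1" if "k < r" for k
    using s[OF that] le[OF that]
    by (intro newton_schulz_scalar_LIMSEQ) (auto simp: divide_simps)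
  then have "(\<lambda>j. svd_prod r u (\<lambda>k. (newton_schulz_scalar ^^ j) (inverse (norm A) * s k)) v)
      \<longlonglongrightarrow> svd_prod r u (\<lambda>_. 1) v"
    by (intro tendsto_svd_prod)
  moreover have "(newton_schulz ^^ j) (inverse (norm A) *\<^sub>R A)
      = svd_prod r u (\<lambda>k. (newton_schulz_scalar ^^ j) (inverse (norm A) * s k)) v" for j
    unfolding newton_schulz_funpow_svd_prod[OF o, symmetric] svd_prod_linear[symmetric] A[symmetric] ..
  ultimately show ?thesis by simp
qed

text \<open>Any two compact SVDs of \<open>A\<close> yield limits of the same sequence, so the
  definite description in \<open>Orth\<close> is well defined.\<close>

lemma Orth_eq_svd_prod:
  assumes "compact_svd A r u s v"
  shows "Orth A = svd_prod r u (\<lambda>_. 1) v"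
proof (cases "A = 0")
  case True
  have o: "orthonormal_columns r u" "orthonormal_columns r v"
    and s: "\<And>k. k < r \<Longrightarrow> 0 < s k" and A: "A = svd_prod r u s v"
    using assms by (auto simp: compact_svd_iff_svd_prod)
  \<comment> \<open>A first singular value would be positive and yet at most \<open>norm 0\<close>,
    so the zero matrix has only the empty decomposition.\<close>
  have "r = 0"
    using singular_value_le_norm[OF o, of 0 s] s[of 0] A True by (cases r) auto
  then show ?thesis using True by (simp add: Orth_def svd_prod_def vec_eq_iff)
next
  case False
  have e: "(\<chi> i j. \<Sum>k<r. u k $ i * v k $ j) = svd_prod r u (\<lambda>_. 1) v"
    for r u and v :: "nat \<Rightarrow> real^'c" by (simp add: svd_prod_def)
  have "(THE Q. \<exists>r u s v. compact_svd A r u s v \<and> Q = svd_prod r u (\<lambda>_. 1) v) = svd_prod r u (\<lambda>_. 1) v"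
  proof (rule the_equality)
    fix Q assume "\<exists>r u s v. compact_svd A r u s v \<and> Q = svd_prod r u (\<lambda>_. 1) v"
    then show "Q = svd_prod r u (\<lambda>_. 1) v"
      using LIMSEQ_unique[OF compact_svd_LIMSEQ compact_svd_LIMSEQ[OF assms]] by auto
  qed (use assms in blast)
  then show ?thesis using False by (simp add: Orth_def e)
qed

lemma newton_schulz_LIMSEQ_Orth:
  "(\<lambda>j. (newton_schulz ^^ j) (inverse (norm A) *\<^sub>R A)) \<longlonglongrightarrow> Orth A"
proof -
  obtain r u s v where svd: "compact_svd A r u s v" using compact_svd_exists by blast
  show ?thesis using compact_svd_LIMSEQ[OF svd] Orth_eq_svd_prod[OF svd] by simp
qed

lemma continuous_on_newton_schulz: "continuous_on UNIV (newton_schulz :: real^'n^'m \<Rightarrow> _)"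
  unfolding newton_schulz_def matrix_matrix_mult_def transpose_def
  by (intro continuous_intros)

lemma borel_measurable_Orth [measurable]: "(Orth :: real^'n^'m \<Rightarrow> _) \<in> borel_measurable borel"
proof (rule borel_measurable_LIMSEQ_metric[OF _ newton_schulz_LIMSEQ_Orth])
  fix j
  have [measurable]: "(newton_schulz :: real^'n^'m \<Rightarrow> _) \<in> borel_measurable borel"
    by (rule borel_measurable_continuous_onI[OF continuous_on_newton_schulz])
  show "(\<lambda>A :: real^'n^'m. (newton_schulz ^^ j) (inverse (norm A) *\<^sub>R A)) \<in> borel_measurable borel"
    by (induction j) simp_all
qed

section \<open>Norm and alignment bounds for the polar factor\<close>

lemma orthonormal_columns_le_dim:
  fixes v :: "nat \<Rightarrow> real^'n"
  assumes "orthonormal_columns r v"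
  shows "r \<le> CARD('n)"
proof -
  have ip: "v k \<bullet> v l = (if k = l then 1 else 0)" if "k < r" "l < r" for k l
    using assms that by (auto simp: orthonormal_columns_def)
  have inj: "inj_on v {..<r}"
  proof (rule inj_onI)
    fix k l assume "k \<in> {..<r}" "l \<in> {..<r}" "v k = v l"
    then show "k = l" using ip[of k l] ip[of l l] by (auto split: if_splits)
  qed
  have "pairwise orthogonal (v ` {..<r})"
    by (auto simp: pairwise_def orthogonal_def ip)
  moreover have "0 \<notin> v ` {..<r}" using ip by force
  ultimately have "independent (v ` {..<r})" by (rule pairwise_orthogonal_independent)
  then have "card (v ` {..<r}) \<le> CARD('n)" using independent_bound by fastforce
  then show ?thesis by (simp add: card_image inj)
qed

text \<open>The squared Frobenius norm of the polar factor is the number of singular values.\<close>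

lemma norm_Orth_le: "norm (Orth A) \<le> sqrt (real CARD('n))" for A :: "real^'n^'m"
proof -
  obtain r u s v where svd: "compact_svd A r u s v" using compact_svd_exists by blast
  then have o: "orthonormal_columns r u" "orthonormal_columns r v" by (auto simp: compact_svd_def)
  have "(norm (Orth A))\<^sup>2 = real r"
    unfolding Orth_eq_svd_prod[OF svd] by (simp add: norm_svd_prod[OF o])
  also have "\<dots> \<le> real CARD('n)" using orthonormal_columns_le_dim[OF o(2)] by simp
  finally show ?thesis by (simp add: real_le_rsqrt)
qed

text \<open>Both sides are sums over \<open>k\<close> of squared entries of row \<open>i\<close> of
  \<open>U\<close>, with weights \<open>s k * s k\<close> on the left and
  \<open>norm A * s k\<close> on the right.\<close>

lemma row_norm_sq_le_inner_Orth:
  fixes A :: "real^'n^'m"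
  shows "(norm (A $ i))\<^sup>2 \<le> norm A * (A $ i \<bullet> Orth A $ i)"
proof -
  obtain r u s v where svd: "compact_svd A r u s v" using compact_svd_exists by blast
  then have o: "orthonormal_columns r u" "orthonormal_columns r v"
    and s: "\<And>k. k < r \<Longrightarrow> 0 < s k" and A: "A = svd_prod r u s v"
    by (auto simp: compact_svd_iff_svd_prod)
  have "(norm (A $ i))\<^sup>2 = (\<Sum>k<r. s k * s k * (u k $ i)\<^sup>2)"
    unfolding A by (simp add: power2_norm_eq_inner svd_prod_inner_rows[OF o(2)])
  also have "\<dots> \<le> (\<Sum>k<r. norm A * (s k * (u k $ i)\<^sup>2))"
  proof (intro sum_mono)
    fix k assume "k \<in> {..<r}"
    then have "s k \<le> norm A" "0 < s k" using s singular_value_le_norm[OF o, of k s] A by auto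
    then show "s k * s k * (u k $ i)\<^sup>2 \<le> norm A * (s k * (u k $ i)\<^sup>2)"
      by (simp add: mult.assoc mult_right_mono)
  qed
  also have "\<dots> = norm A * (A $ i \<bullet> Orth A $ i)"
    unfolding Orth_eq_svd_prod[OF svd]
    by (subst (3) A) (simp add: svd_prod_inner_rows[OF o(2)] sum_distrib_left)
  finally show ?thesis .
qed

section \<open>Row normalization\<close>

lemma diag_mat_mult_nth: "(diag_mat d ** A) $ i $ j = d $ i * A $ i $ j"
  by (simp add: matrix_matrix_mult_def diag_mat_def if_distrib if_distribR cong: if_cong)

lemma mult_diag_mat_nth: "(A ** diag_mat d) $ i $ j = A $ i $ j * d $ j"
  by (simp add: matrix_matrix_mult_def diag_mat_def if_distrib cong: if_cong)

lemma diag_mat_mult_vec_nth: "(diag_mat d *v x) $ i = d $ i * x $ i"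
  by (simp add: matrix_vector_mult_def diag_mat_def if_distrib if_distribR cong: if_cong)

lemma pos_semidef_diag_mat:
  assumes "\<And>i. 0 \<le> d $ i"
  shows "pos_semidef (diag_mat d)"
proof -
  have "0 \<le> x \<bullet> (diag_mat d *v x)" for x
    unfolding inner_vec_def diag_mat_mult_vec_nth
    by (intro sum_nonneg) (simp add: assms mult.left_commute)
  then show ?thesis
    by (auto simp: pos_semidef_def transpose_def diag_mat_def vec_eq_iff)
qed

lemma symmetric_inner_mult_vec:
  assumes "transpose A = (A :: real^'m^'m)"
  shows "x \<bullet> (A *v y) = (A *v x) \<bullet> y"
  using assms by (metis dot_lmul_matrix transpose_matrix_vector)

text \<open>The form is nonnegative along every line \<open>y + t w\<close> and vanishes at
  \<open>y\<close>, so its slope \<open>2 * (w \<bullet> (B *v y))\<close> is zero for every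
  \<open>w\<close>.\<close>

lemma pos_semidef_inner_eq_0D:
  assumes B: "pos_semidef B" and y: "y \<bullet> (B *v y) = 0"
  shows "B *v y = 0"
proof -
  have sym: "transpose B = B" using B by (simp add: pos_semidef_def)
  have "- (w \<bullet> (B *v y)) = 0" for w
  proof (rule eq_zero_if_linear_le_quadratic)
    fix t :: real
    have "0 \<le> (y + t *\<^sub>R w) \<bullet> (B *v (y + t *\<^sub>R w))" using B by (simp add: pos_semidef_def)
    also have "\<dots> = 2 * t * (w \<bullet> (B *v y)) + t\<^sup>2 * (w \<bullet> (B *v w))"
      using symmetric_inner_mult_vec[OF sym, of y w] y
      by (simp add: matrix_vector_right_distrib matrix_vector_mult_scaleR inner_add_left
          inner_add_right inner_commute power2_eq_square algebra_simps)
    finally show "2 * t * - (w \<bullet> (B *v y)) \<le> t\<^sup>2 * (w \<bullet> (B *v w))" by simp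
  qed
  then show ?thesis by (metis inner_eq_zero_iff neg_equal_0_iff_equal)
qed

text \<open>Both square roots commute, so \<open>(B - C) (B + C) = 0\<close>; positivity of \<open>B\<close> and \<open>C\<close> on the
  range of \<open>B - C\<close> then forces \<open>(B - C)\<^sup>2 = 0\<close>.\<close>

lemma pos_semidef_sqrt_diag_unique:
  fixes B :: "real^'m^'m"
  assumes B: "pos_semidef B" and BB: "B ** B = diag_mat d" and d: "\<And>i. 0 \<le> d $ i"
  shows "B = diag_mat (\<chi> i. sqrt (d $ i))"
proof -
  define C where "C = diag_mat (\<chi> i. sqrt (d $ i))"
  have C: "pos_semidef C" unfolding C_def by (rule pos_semidef_diag_mat) (simp add: d)
  have CC: "C ** C = diag_mat d"
    by (simp add: vec_eq_iff diag_mat_mult_nth C_def) (simp add: diag_mat_def d)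
  have "B ** diag_mat d = diag_mat d ** B"
    using BB matrix_mul_assoc by metis
  then have comm_d: "B $ i $ j * d $ j = d $ i * B $ i $ j" for i j
    by (metis diag_mat_mult_nth mult_diag_mat_nth)
  \<comment> \<open>Where \<open>B $ i $ j\<close> is nonzero, commuting with
    \<open>diag_mat d\<close> forces \<open>d $ i = d $ j\<close>, hence equal square roots.\<close>
  have "B $ i $ j * sqrt (d $ j) = sqrt (d $ i) * B $ i $ j" for i j
    using comm_d[of i j] by (cases "B $ i $ j = 0") auto
  then have comm: "B ** C = C ** B"
    by (simp add: vec_eq_iff C_def diag_mat_mult_nth mult_diag_mat_nth)
  define E where "E = B - C"
  have sym: "transpose E = E"
    using B C by (auto simp: pos_semidef_def E_def transpose_def vec_eq_iff)
  have zero: "E *v (B *v y + C *v y) = 0" for y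
    using BB CC comm
    unfolding E_def matrix_vector_mult_diff_rdistrib matrix_vector_right_distrib
    by (simp add: matrix_vector_mul_assoc)
  have "E *v x = 0" for x
  proof -
    define y where "y = E *v x"
    \<comment> \<open>By symmetry of \<open>E\<close> this is the inner product of \<open>x\<close>
      with \<open>E *v (B *v y + C *v y)\<close>, which is zero. Two nonnegative summands then
      vanish separately.\<close>
    have "y \<bullet> (B *v y + C *v y) = 0"
      unfolding y_def using symmetric_inner_mult_vec[OF sym] zero by (metis inner_zero_right)
    then have "y \<bullet> (B *v y) = 0 \<and> y \<bullet> (C *v y) = 0"
      using B C by (auto simp: pos_semidef_def inner_add_right add_nonneg_eq_0_iff)
    then have "B *v y = 0" "C *v y = 0"
      using pos_semidef_inner_eq_0D[OF B] pos_semidef_inner_eq_0D[OF C] by blast+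
    then have "E *v y = 0" by (simp add: E_def matrix_vector_mult_diff_rdistrib)
    then have "y \<bullet> y = 0"
      using symmetric_inner_mult_vec[OF sym, of x y] by (simp add: y_def)
    then show ?thesis by (simp add: y_def)
  qed
  then have "E = 0" by (simp add: matrix_eq)
  then show ?thesis by (simp add: E_def C_def)
qed

lemma mat_sqrt_diag_mat:
  assumes "\<And>i. 0 \<le> d $ i"
  shows "mat_sqrt (diag_mat d) = diag_mat (\<chi> i. sqrt (d $ i))"
  unfolding mat_sqrt_def
proof (rule the_equality)
  let ?C = "diag_mat (\<chi> i. sqrt (d $ i))"
  have "?C ** ?C = diag_mat d"
    by (simp add: vec_eq_iff diag_mat_mult_nth) (simp add: diag_mat_def assms)
  then show "pos_semidef ?C \<and> ?C ** ?C = diag_mat d"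
    by (simp add: pos_semidef_diag_mat assms)
qed (use pos_semidef_sqrt_diag_unique assms in auto)

text \<open>\<open>A ** P\<close> and \<open>A ** Q\<close> are both the orthogonal projection onto
  the range of \<open>A\<close>, hence equal; likewise \<open>P ** A = Q ** A\<close>. Then
  \<open>P = P ** A ** P = Q ** A ** Q = Q\<close>.\<close>

lemma is_pinv_unique:
  assumes "is_pinv A P" "is_pinv A Q"
  shows "P = Q"
proof -
  have P: "A ** P ** A = A" "P ** A ** P = P" "transpose (A ** P) = A ** P" "transpose (P ** A) = P ** A"
    and Q: "A ** Q ** A = A" "Q ** A ** Q = Q" "transpose (A ** Q) = A ** Q" "transpose (Q ** A) = Q ** A"
    using assms by (auto simp: is_pinv_def)
  have "A ** P = transpose (A ** Q ** A ** P)" using P Q by simp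
  also have "\<dots> = (A ** P) ** (A ** Q)"
    by (metis P(3) Q(3) matrix_mul_assoc matrix_transpose_mul)
  also have "\<dots> = A ** Q" using P(1) by (simp add: matrix_mul_assoc)
  finally have AP: "A ** P = A ** Q" .
  have "P ** A = transpose (P ** (A ** Q ** A))" using P Q by simp
  also have "\<dots> = (Q ** A) ** (P ** A)"
    by (metis P(4) Q(4) matrix_mul_assoc matrix_transpose_mul)
  also have "\<dots> = Q ** A" using P(1) by (metis matrix_mul_assoc)
  finally have PA: "P ** A = Q ** A" .
  have "P = P ** A ** P" using P by simp
  also have "\<dots> = Q ** A ** Q" using AP PA by (metis matrix_mul_assoc)
  finally show ?thesis using Q by simp
qed

text \<open>Zero diagonal entries are harmless here because \<open>inverse 0 = 0\<close>.\<close>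

lemma pinv_diag_mat: "pinv (diag_mat d) = diag_mat (\<chi> i. inverse (d $ i))"
  unfolding pinv_def
proof (rule the_equality)
  show *: "is_pinv (diag_mat d) (diag_mat (\<chi> i. inverse (d $ i)))"
    by (simp add: is_pinv_def vec_eq_iff transpose_def mult_diag_mat_nth)
      (simp add: diag_mat_def field_simps)
  show "P = diag_mat (\<chi> i. inverse (d $ i))" if "is_pinv (diag_mat d) P" for P
    using is_pinv_unique[OF that *] .
qed

text \<open>The diagonal matrix holds the squared row norms, so its root holds the row norms. Zero
  rows stay zero since \<open>inverse 0 = 0\<close>.\<close>

lemma row_normalize_eq: "row_normalize A = (\<chi> i. inverse (norm (A $ i)) *\<^sub>R A $ i)"
proof -
  have "rowsum (A * A) $ i = (norm (A $ i))\<^sup>2" for i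
    unfolding rowsum_def power2_norm_eq_inner by (simp add: inner_vec_def)
  then have "mat_sqrt (diag_mat (rowsum (A * A))) = diag_mat (\<chi> i. norm (A $ i))"
    by (simp add: mat_sqrt_diag_mat)
  then show ?thesis
    unfolding row_normalize_def by (simp add: pinv_diag_mat diag_mat_mult_nth) (simp add: vec_eq_iff diag_mat_mult_nth)
qed

text \<open>The map is discontinuous at matrices with a zero row, so measurability is read off
  coordinatewise from the closed form.\<close>

lemma borel_measurable_row_normalize [measurable]:
  "(row_normalize :: real^'n^'m \<Rightarrow> _) \<in> borel_measurable borel"
proof -
  have nth: "(\<lambda>A :: real^'n^'m. A $ i) \<in> borel_measurable borel" for i
    by (intro borel_measurable_continuous_onI continuous_intros)
  have nth': "(\<lambda>x :: real^'n. x $ j) \<in> borel_measurable borel" for j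
    by (intro borel_measurable_continuous_onI continuous_intros)
  have row: "(\<lambda>A :: real^'n^'m. inverse (norm (A $ i)) * A $ i $ j) \<in> borel_measurable borel" for i j
    using nth[of i, measurable] measurable_compose[OF nth nth', measurable] by measurable
  show ?thesis
  proof (rule borel_measurable_euclidean_space[THEN iffD2], rule ballI)
    fix b :: "real^'n^'m" assume "b \<in> Basis"
    then obtain i j where b: "b = axis i (axis j 1)" by (auto simp: Basis_vec_def)
    show "(\<lambda>A. row_normalize A \<bullet> b) \<in> borel_measurable borel"
      using row[of i j] by (simp add: b row_normalize_eq inner_axis)
  qed
qed

lemma norm_row_normalize_le: "norm (row_normalize A) \<le> sqrt (real CARD('m))"
  for A :: "real^'n^'m"
proof -
  have "(norm (row_normalize A))\<^sup>2 = (\<Sum>i\<in>UNIV. (norm (row_normalize A $ i))\<^sup>2)"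
    unfolding power2_norm_eq_inner by (subst inner_vec_def) simp
  also have "\<dots> \<le> (\<Sum>i\<in>(UNIV::'m set). 1)"
    by (intro sum_mono power_le_one) (auto simp: row_normalize_eq divide_inverse[symmetric] mult.commute)
  finally show ?thesis by (simp add: real_le_rsqrt)
qed

lemma norm_le_sum_norm_rows: "norm A \<le> (\<Sum>i\<in>UNIV. norm (A $ i))" for A :: "real^'n^'m"
  by (simp add: norm_vec_def L2_set_le_sum)

text \<open>Row by row: a nonzero row of \<open>A\<close> is a multiple of a unit row of
  \<open>N\<close>, where \<open>1 \<le> norm N * (N $ i \<bullet> Orth N $ i)\<close> and
  \<open>norm N\<close> is at most \<open>sqrt m\<close>. Summing gives the sum of the row norms,
  which dominates the Frobenius norm.\<close>

lemma inner_Orth_row_normalize_ge: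
  fixes A :: "real^'n^'m"
  shows "norm A / sqrt (real CARD('m)) \<le> A \<bullet> Orth (row_normalize A)"
proof -
  define N where "N = row_normalize A"
  define c where "c = sqrt (real CARD('m))"
  have c: "c > 0" by (simp add: c_def)
  have "norm (A $ i) / c \<le> A $ i \<bullet> Orth N $ i" for i
  proof (cases "A $ i = 0")
    case False
    have Ai: "A $ i = norm (A $ i) *\<^sub>R N $ i" using False by (simp add: N_def row_normalize_eq)
    have "1 = (norm (N $ i))\<^sup>2" using False by (simp add: N_def row_normalize_eq)
    also have le: "\<dots> \<le> norm N * (N $ i \<bullet> Orth N $ i)" by (rule row_norm_sq_le_inner_Orth)
    finally have pos: "1 \<le> norm N * (N $ i \<bullet> Orth N $ i)" .
    \<comment> \<open>Positivity permits replacing \<open>norm N\<close> by the larger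
      \<open>c\<close>.\<close>
    then have "0 < N $ i \<bullet> Orth N $ i"
      by (smt (verit) norm_ge_zero mult_nonneg_nonpos)
    then have "norm N * (N $ i \<bullet> Orth N $ i) \<le> c * (N $ i \<bullet> Orth N $ i)"
      using norm_row_normalize_le[of A] by (intro mult_right_mono) (auto simp: N_def c_def)
    then have "1 / c \<le> N $ i \<bullet> Orth N $ i" using pos c by (simp add: field_simps)
    then have "norm (A $ i) * (1 / c) \<le> norm (A $ i) * (N $ i \<bullet> Orth N $ i)"
      by (intro mult_left_mono) auto
    also have "\<dots> = A $ i \<bullet> Orth N $ i" by (subst (2) Ai) simp
    finally show ?thesis by simp
  qed simp
  then have "(\<Sum>i\<in>UNIV. norm (A $ i) / c) \<le> A \<bullet> Orth N"
    by (subst inner_vec_def) (intro sum_mono)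
  moreover have "norm A / c \<le> (\<Sum>i\<in>UNIV. norm (A $ i) / c)"
    using norm_le_sum_norm_rows[of A] c by (simp add: sum_divide_distrib[symmetric] divide_right_mono)
  ultimately show ?thesis by (simp add: N_def c_def)
qed

section \<open>Gradients\<close>

lemma gderiv_line:
  fixes f :: "'a::real_inner \<Rightarrow> real"
  assumes "GDERIV f (x + t *\<^sub>R d) :> g"
  shows "((\<lambda>t. f (x + t *\<^sub>R d)) has_real_derivative g \<bullet> d) (at t)"
proof -
  have "((\<lambda>t. f (x + t *\<^sub>R d)) has_derivative (\<lambda>h. (h *\<^sub>R d) \<bullet> g)) (at t)"
    by (rule has_derivative_compose[where f = "\<lambda>t. x + t *\<^sub>R d" and g = f
          and g' = "\<lambda>h. h \<bullet> g", OF _ assms[unfolded gderiv_def]])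
      (auto intro!: derivative_eq_intros)
  then show ?thesis
    by (rule has_derivative_imp_has_field_derivative) (simp add: inner_commute)
qed

text \<open>\<open>\<phi>\<close> is \<open>f\<close> along the segment minus its quadratic model.
  The Lipschitz bound makes its derivative nonpositive, so comparing the endpoints avoids
  integrating the gradient.\<close>

lemma gderiv_descent:
  fixes f :: "'a::euclidean_space \<Rightarrow> real"
  assumes grad: "\<And>x. GDERIV f x :> g x"
    and lip: "\<And>x y. norm (g y - g x) \<le> L * norm (y - x)"
  shows "f y \<le> f x + g x \<bullet> (y - x) + L / 2 * (norm (y - x))\<^sup>2"
proof -
  define d where "d = y - x"
  define \<phi> where "\<phi> t = f (x + t *\<^sub>R d) - t * (g x \<bullet> d) - t\<^sup>2 * (L / 2 * (norm d)\<^sup>2)" for t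
  have der: "(\<phi> has_real_derivative (g (x + t *\<^sub>R d) - g x) \<bullet> d - L * t * (norm d)\<^sup>2) (at t)" for t
    unfolding \<phi>_def using gderiv_line[OF grad]
    by (auto intro!: derivative_eq_intros simp: inner_diff_left algebra_simps)
  have "\<phi> 1 \<le> \<phi> 0"
  proof (rule DERIV_nonpos_imp_nonincreasing[of 0 1 \<phi>])
    fix t :: real assume t: "0 \<le> t" "t \<le> 1"
    have "(g (x + t *\<^sub>R d) - g x) \<bullet> d \<le> norm (g (x + t *\<^sub>R d) - g x) * norm d"
      by (rule norm_cauchy_schwarz)
    also have "\<dots> \<le> (L * norm (t *\<^sub>R d)) * norm d"
      using lip[of "x + t *\<^sub>R d" x] by (intro mult_right_mono) auto
    also have "\<dots> = L * t * (norm d)\<^sup>2" using t by (simp add: power2_eq_square)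
    finally show "\<exists>y. (\<phi> has_real_derivative y) (at t) \<and> y \<le> 0" using der[of t] by auto
  qed simp
  then show ?thesis by (simp add: \<phi>_def d_def)
qed

text \<open>Simple functions \<open>s i\<close> approximate the identity. With finitely many values
  in the first argument joint measurability is a gluing of sections, and continuity in
  \<open>y\<close> passes it to the limit.\<close>

lemma measurable_Caratheodory:
  fixes F :: "'a::euclidean_space \<Rightarrow> 'z \<Rightarrow> real"
  assumes meas: "\<And>y. F y \<in> borel_measurable D"
    and cont: "\<And>z. z \<in> space D \<Longrightarrow> continuous_on UNIV (\<lambda>y. F y z)"
  shows "(\<lambda>(y, z). F y z) \<in> borel_measurable (borel \<Otimes>\<^sub>M D)"
proof -
  have "(\<lambda>y. y) \<in> borel_measurable (borel :: 'a measure)" by simp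
  from borel_measurable_implies_sequence_metric[OF this, of 0]
  obtain s :: "nat \<Rightarrow> 'a \<Rightarrow> 'a" where s: "\<And>i. simple_function borel (s i)" "\<And>y. (\<lambda>i. s i y) \<longlonglongrightarrow> y"
    by auto
  show ?thesis
  proof (rule borel_measurable_LIMSEQ_metric)
    fix i
    have "(\<lambda>p. F (s i (fst p)) (snd p)) \<in> borel_measurable (borel \<Otimes>\<^sub>M D)"
    proof (rule measurable_compose_countable'[where I = "range (s i)" and g = "\<lambda>p. s i (fst p)"])
      show "(\<lambda>p. F y (snd p)) \<in> borel_measurable (borel \<Otimes>\<^sub>M D)" for y
        by (rule measurable_compose[OF measurable_snd meas])
      have "s i \<in> measurable borel (count_space (range (s i)))"
        using s(1)[of i] by (simp add: measurable_simple_function simple_function_def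
            measurable_count_space_eq2)
      then show "(\<lambda>p. s i (fst p)) \<in> measurable (borel \<Otimes>\<^sub>M D) (count_space (range (s i)))"
        by (rule measurable_compose[OF measurable_fst])
      show "countable (range (s i))"
        using s(1)[of i] by (auto simp: simple_function_def intro: countable_finite)
    qed
    then show "(\<lambda>(y, z). F (s i y) z) \<in> borel_measurable (borel \<Otimes>\<^sub>M D)"
      by (simp add: case_prod_unfold)
  next
    fix p :: "'a \<times> 'z" assume "p \<in> space (borel \<Otimes>\<^sub>M D)"
    then have z: "snd p \<in> space D" by (auto simp: space_pair_measure)
    have "(\<lambda>i. F (s i (fst p)) (snd p)) \<longlonglongrightarrow> F (fst p) (snd p)"
      using continuous_on_tendsto_compose[OF cont[OF z] s(2)] by simp
    then show "(\<lambda>i. case p of (y, z) \<Rightarrow> F (s i y) z) \<longlonglongrightarrow> (case p of (y, z) \<Rightarrow> F y z)"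
      by (simp add: case_prod_unfold)
  qed
qed

text \<open>Each coordinate of the gradient is a limit of difference quotients of the jointly
  measurable \<open>F\<close>. Joint measurability is what allows random iterates to be substituted
  for \<open>y\<close>.\<close>

lemma measurable_gradient_Caratheodory:
  fixes F :: "'a::euclidean_space \<Rightarrow> 'z \<Rightarrow> real"
  assumes meas: "\<And>y. F y \<in> borel_measurable D"
    and grad: "\<And>y z. z \<in> space D \<Longrightarrow> GDERIV (\<lambda>y. F y z) y :> G y z"
  shows "(\<lambda>(y, z). G y z) \<in> borel_measurable (borel \<Otimes>\<^sub>M D)"
proof (rule borel_measurable_euclidean_space[THEN iffD2], rule ballI)
  fix b :: 'a assume "b \<in> Basis"
  define \<delta> where "\<delta> k = inverse (real (Suc k))" for k
  have "continuous_on UNIV (\<lambda>y. F y z)" if "z \<in> space D" for z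
    using grad[OF that] unfolding gderiv_def
    by (auto intro!: continuous_at_imp_continuous_on has_derivative_continuous)
  then have [measurable]: "(\<lambda>(y, z). F y z) \<in> borel_measurable (borel \<Otimes>\<^sub>M D)"
    using meas by (intro measurable_Caratheodory)
  show "(\<lambda>p. (case p of (y, z) \<Rightarrow> G y z) \<bullet> b) \<in> borel_measurable (borel \<Otimes>\<^sub>M D)"
  proof (rule borel_measurable_LIMSEQ_metric)
    fix k
    have "(\<lambda>p. (\<lambda>(y, z). F y z) (fst p + \<delta> k *\<^sub>R b, snd p)) \<in> borel_measurable (borel \<Otimes>\<^sub>M D)"
      "(\<lambda>p. (\<lambda>(y, z). F y z) (fst p, snd p)) \<in> borel_measurable (borel \<Otimes>\<^sub>M D)"
      by measurable
    then show "(\<lambda>p. (F (fst p + \<delta> k *\<^sub>R b) (snd p) - F (fst p) (snd p)) / \<delta> k)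
        \<in> borel_measurable (borel \<Otimes>\<^sub>M D)"
      by simp
  next
    fix p :: "'a \<times> 'z" assume "p \<in> space (borel \<Otimes>\<^sub>M D)"
    then have z: "snd p \<in> space D" by (auto simp: space_pair_measure)
    have "((\<lambda>t. F (fst p + t *\<^sub>R b) (snd p)) has_real_derivative (G (fst p) (snd p) \<bullet> b)) (at 0)"
      by (rule gderiv_line[where f = "\<lambda>y. F y (snd p)"]) (simp add: grad[OF z])
    then have lim: "((\<lambda>h. (F (fst p + h *\<^sub>R b) (snd p) - F (fst p) (snd p)) / h)
        \<longlongrightarrow> G (fst p) (snd p) \<bullet> b) (at 0)"
      unfolding has_field_derivative_iff by simp
    have "filterlim \<delta> (at 0) sequentially"
      unfolding filterlim_at using LIMSEQ_inverse_real_of_nat by (auto simp: \<delta>_def[abs_def])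
    from filterlim_compose[OF lim this]
    show "(\<lambda>k. (F (fst p + \<delta> k *\<^sub>R b) (snd p) - F (fst p) (snd p)) / \<delta> k)
        \<longlonglongrightarrow> (case p of (y, z) \<Rightarrow> G y z) \<bullet> b"
      by (simp add: case_prod_unfold)
  qed
qed

section \<open>Step sizes and the momentum error sum\<close>

text \<open>Every power of \<open>t\<close> in the step sizes is an integral power of the fourth
  root \<open>x\<close>, so later estimates become rational in \<open>x\<close>.\<close>

lemma obtain_root4:
  assumes "1 \<le> (t::nat)"
  obtains x where "0 < x" "real t = x ^ 4" "sqrt (real t) = x\<^sup>2" "real t powr (-(3/4)) = 1 / x ^ 3"
    "real t powr (-(1/2)) = 1 / x\<^sup>2" "real t powr (1/4) = x" "real t powr (-(1/4)) = 1 / x"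
proof -
  define x where "x = real t powr (1/4)"
  have t: "real t > 0" using assms by simp
  have x: "0 < x" using t by (simp add: x_def)
  have pw: "x ^ k = real t powr (real k / 4)" for k
    using x t by (simp add: x_def powr_realpow[symmetric] powr_powr)
  have "real t = x ^ 4" using pw[of 4] t by simp
  moreover have "sqrt (real t) = x\<^sup>2" using pw[of 2] t by (simp add: powr_half_sqrt)
  moreover have "real t powr (-(3/4)) = 1 / x ^ 3" using pw[of 3] by (simp add: powr_minus_divide)
  moreover have "real t powr (-(1/2)) = 1 / x\<^sup>2" using pw[of 2] by (simp add: powr_minus_divide)
  moreover have "real t powr (-(1/4)) = 1 / x" using pw[of 1] by (simp add: powr_minus_divide)
  ultimately show ?thesis using that x x_def by blast
qed

text \<open>For consecutive fourth roots \<open>x\<close> and \<open>y\<close>, factoring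
  \<open>1 = y^4 - x^4\<close> gives \<open>1 / y^3 \<le> 4 * (y - x)\<close>, which
  telescopes.\<close>

lemma sum_powr_three_quarters_le:
  "(\<Sum>s=1..n. real s powr (-(3/4))) \<le> 4 * real n powr (1/4)"
proof (induction n)
  case (Suc n)
  obtain y where y: "0 < y" "real (Suc n) = y ^ 4" "real (Suc n) powr (-(3/4)) = 1 / y ^ 3"
    "real (Suc n) powr (1/4) = y" using obtain_root4[of "Suc n"] by auto
  define x where "x = real n powr (1/4)"
  have x: "0 \<le> x" "x \<le> y" unfolding x_def y(4)[symmetric] by (auto intro!: powr_mono2)
  have "x ^ 4 = real n" by (cases "n = 0") (simp_all add: x_def powr_realpow[symmetric] powr_powr)
  then have "1 = y ^ 4 - x ^ 4" using y by simp
  also have "\<dots> = (y - x) * (y ^ 3 + y\<^sup>2 * x + y * x\<^sup>2 + x ^ 3)"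
    by (simp add: algebra_simps power2_eq_square power3_eq_cube power4_eq_xxxx)
  also have "\<dots> \<le> (y - x) * (y ^ 3 + y ^ 3 + y ^ 3 + y ^ 3)"
  proof (intro mult_left_mono add_mono)
    show "y\<^sup>2 * x \<le> y ^ 3" using x y(1) by (simp add: power3_eq_cube power2_eq_square)
    show "y * x\<^sup>2 \<le> y ^ 3"
      using x y(1) by (simp add: power3_eq_cube power2_eq_square mult_mono)
    show "x ^ 3 \<le> y ^ 3" using x by (intro power_mono)
  qed (use x in auto)
  finally have "1 / y ^ 3 \<le> 4 * (y - x)" using y(1) by (simp add: field_simps)
  then show ?case using Suc y by (simp add: x_def)
qed simp

text \<open>The difference between the harmonic number and the logarithm decreases from its value 1
  at \<open>n = 1\<close>.\<close>

lemma sum_inverse_le_ln: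
  assumes "1 \<le> n"
  shows "(\<Sum>t=1..n. 1 / real t) \<le> 1 + ln (real n)"
proof -
  have "harm n - ln (of_nat n) \<le> harm 1 - ln (of_nat 1 :: real)"
    using decseqD[OF decseq_harm_diff_ln, of 0 "n - 1"] assms by simp
  then show ?thesis by (simp add: harm_def divide_inverse)
qed

text \<open>The squared step sizes are \<open>t\<close> to the power -3/2, and the term at
  \<open>Suc n\<close> is at most \<open>2 / sqrt n - 2 / sqrt (Suc n)\<close>. Subtracting
  \<open>2 / sqrt n\<close> makes the induction close; only the bound 3 matters later.\<close>

lemma sum_powr_three_halves_le:
  assumes "1 \<le> n"
  shows "(\<Sum>t=1..n. (real t powr (-(3/4)))\<^sup>2) \<le> 3 - 2 / sqrt (real n)"
  using assms
proof (induction n rule: nat_induct_at_least)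
  case (Suc n)
  obtain y where y: "0 < y" "real (Suc n) = y ^ 4" "real (Suc n) powr (-(3/4)) = 1 / y ^ 3"
    "sqrt (real (Suc n)) = y\<^sup>2" using obtain_root4[of "Suc n"] by auto
  define b where "b = y\<^sup>2"
  define a where "a = sqrt (real n)"
  have ab: "0 < a" "a \<le> b" unfolding a_def b_def y(4)[symmetric] using Suc by auto
  have "b\<^sup>2 = real (Suc n)" using y by (simp add: b_def)
  then have "1 = b\<^sup>2 - a\<^sup>2" by (simp add: a_def)
  also have "\<dots> = (b - a) * (b + a)" by (simp add: algebra_simps power2_eq_square)
  also have "\<dots> \<le> (b - a) * (2 * b)" using ab by (intro mult_left_mono) auto
  finally have "1 / b ^ 3 \<le> 2 * (b - a) / (b * b)"
    using ab by (simp add: field_simps power3_eq_cube)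
  also have "\<dots> \<le> 2 * (b - a) / (a * b)"
    using ab by (intro divide_left_mono mult_right_mono mult_pos_pos) auto
  also have "\<dots> = 2 / a - 2 / b" using ab by (simp add: field_simps)
  finally have "1 / b ^ 3 \<le> 2 / a - 2 / b" .
  moreover have "(real (Suc n) powr (-(3/4)))\<^sup>2 = 1 / b ^ 3"
    unfolding y(3) b_def by (simp add: power_divide power_mult[symmetric])
  ultimately show ?case using Suc y(4) by (simp add: a_def b_def)
qed simp

text \<open>Solving the recursion for its contraction term bounds \<open>e t / sqrt (Suc t)\<close>
  by \<open>e t - e (Suc t)\<close> plus a multiple of \<open>1 / t\<close>; the sum telescopes up
  to a harmonic sum.\<close>

lemma weighted_error_sum_le:
  fixes e :: "nat \<Rightarrow> real"
  assumes e0: "\<And>t. 0 \<le> e t" and e1: "e 1 \<le> S" and P: "0 \<le> P" and S: "0 \<le> S"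
    and rec: "\<And>t. 1 \<le> t \<Longrightarrow> e (Suc t) \<le> (1 - 1 / sqrt (real (Suc t))) * e t
      + sqrt (real (Suc t)) * (P * (real t powr (-(3/4)))\<^sup>2) + S / real (Suc t)"
    and T: "1 \<le> T"
  shows "(\<Sum>t=1..T. e t / sqrt (real t)) \<le> sqrt 2 * (S + (sqrt 2 * P + S) * (1 + ln (real T)))"
proof -
  have step: "e t / sqrt (real t) \<le> sqrt 2 * (e t - e (Suc t) + (sqrt 2 * P + S) * (1 / real t))"
    if t: "1 \<le> t" for t
  proof -
    obtain x where x: "0 < x" "real t = x ^ 4" "sqrt (real t) = x\<^sup>2"
      "real t powr (-(3/4)) = 1 / x ^ 3" using obtain_root4[OF t] by auto
    \<comment> \<open>Sharp at \<open>t = 1\<close>. It serves twice: to move the weight from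
      \<open>Suc t\<close> to \<open>t\<close>, and to bound the drift term by
      \<open>sqrt 2 * P / t\<close>.\<close>
    have le: "sqrt (real (Suc t)) \<le> sqrt 2 * sqrt (real t)"
      using t by (simp add: real_sqrt_mult[symmetric])
    have "e t / sqrt (real t) \<le> sqrt 2 * (e t / sqrt (real (Suc t)))"
    proof -
      have "e t * sqrt (real (Suc t)) \<le> e t * (sqrt 2 * sqrt (real t))"
        using le e0 by (rule mult_left_mono)
      then show ?thesis using t by (simp add: field_simps)
    qed
    moreover have "e t / sqrt (real (Suc t)) \<le> e t - e (Suc t) + (sqrt 2 * P + S) * (1 / real t)"
    proof -
      have "sqrt (real (Suc t)) * (P * (real t powr (-(3/4)))\<^sup>2)
          \<le> (sqrt 2 * sqrt (real t)) * (P * (real t powr (-(3/4)))\<^sup>2)"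
        using le P by (intro mult_right_mono) auto
      also have "\<dots> = sqrt 2 * P * (1 / real t)"
        unfolding x(4) using x by (simp add: power_divide power_mult[symmetric] field_simps power_add[symmetric])
      finally have "sqrt (real (Suc t)) * (P * (real t powr (-(3/4)))\<^sup>2) \<le> sqrt 2 * P * (1 / real t)" .
      moreover have "S / real (Suc t) \<le> S * (1 / real t)"
        using S t by (simp add: frac_le)
      ultimately show ?thesis using rec[OF t] by (simp add: algebra_simps)
    qed
    then have "sqrt 2 * (e t / sqrt (real (Suc t)))
        \<le> sqrt 2 * (e t - e (Suc t) + (sqrt 2 * P + S) * (1 / real t))"
      by (intro mult_left_mono) auto
    ultimately show ?thesis by linarith
  qed
  have "(\<Sum>t=1..T. e t / sqrt (real t))
      \<le> (\<Sum>t=1..T. sqrt 2 * (e t - e (Suc t) + (sqrt 2 * P + S) * (1 / real t)))"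
    by (intro sum_mono step) auto
  also have "\<dots> = sqrt 2 * ((\<Sum>t=1..T. e t - e (Suc t)) + (sqrt 2 * P + S) * (\<Sum>t=1..T. 1 / real t))"
    by (simp only: sum_distrib_left[symmetric] sum.distrib)
  also have "(\<Sum>t=1..T. e t - e (Suc t)) = e 1 - e (Suc T)"
    using T by (induction T rule: nat_induct_at_least) simp_all
  also have "sqrt 2 * (e 1 - e (Suc T) + (sqrt 2 * P + S) * (\<Sum>t=1..T. 1 / real t))
      \<le> sqrt 2 * (S + (sqrt 2 * P + S) * (1 + ln (real T)))"
    using e1 e0[of "Suc T"] sum_inverse_le_ln[OF T] P S
    by (intro mult_left_mono add_mono) auto
  finally show ?thesis .
qed

section \<open>One step of the iteration\<close>

text \<open>Young's inequality weighted so that \<open>(norm u)^2\<close> keeps exactly the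
  contraction factor \<open>\<beta>\<close>. The cross term is bounded through the square of
  \<open>(1 - \<beta>) u - \<beta> w\<close>, without division by \<open>\<beta>\<close>.\<close>

lemma convex_combination_norm_sq_le:
  fixes u w :: "'a::real_inner"
  assumes "0 \<le> \<beta>" "\<beta> < 1"
  shows "(norm (\<beta> *\<^sub>R (u + w)))\<^sup>2 \<le> \<beta> * (norm u)\<^sup>2 + (norm w)\<^sup>2 / (1 - \<beta>)"
proof -
  define c where "c = 1 - \<beta>"
  have c: "0 < c" "\<beta> = 1 - c" "c \<le> 1" using assms by (auto simp: c_def)
  have "0 \<le> (norm (c *\<^sub>R u + (- \<beta>) *\<^sub>R w))\<^sup>2" by simp
  also have "\<dots> = c\<^sup>2 * (norm u)\<^sup>2 - 2 * c * \<beta> * (u \<bullet> w) + \<beta>\<^sup>2 * (norm w)\<^sup>2"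
    unfolding norm_add_scaleR_sq by (simp add: power_mult_distrib)
  finally have *: "2 * c * \<beta> * (u \<bullet> w) \<le> c\<^sup>2 * (norm u)\<^sup>2 + \<beta>\<^sup>2 * (norm w)\<^sup>2" by simp
  have "c * (norm (u + w))\<^sup>2 * \<beta> = c * \<beta> * (norm u)\<^sup>2 + 2 * c * \<beta> * (u \<bullet> w) + c * \<beta> * (norm w)\<^sup>2"
    using norm_add_scaleR_sq[of u 1 w] by (simp add: algebra_simps)
  also have "\<dots> \<le> (c * \<beta> + c\<^sup>2) * (norm u)\<^sup>2 + (c * \<beta> + \<beta>\<^sup>2) * (norm w)\<^sup>2"
    using * by (simp add: algebra_simps)
  also have "\<dots> = c * (norm u)\<^sup>2 + \<beta> * (norm w)\<^sup>2"
    by (simp add: c(2) algebra_simps power2_eq_square)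
  finally have "c * (\<beta> * (norm (u + w))\<^sup>2) \<le> c * ((norm u)\<^sup>2 + \<beta> * (norm w)\<^sup>2 / c)"
    using c(1) by (simp add: distrib_left mult_ac)
  then have "\<beta> * (norm (u + w))\<^sup>2 \<le> (norm u)\<^sup>2 + \<beta> * (norm w)\<^sup>2 / c"
    using c(1) by simp
  then have "\<beta> * (\<beta> * (norm (u + w))\<^sup>2) \<le> \<beta> * ((norm u)\<^sup>2 + \<beta> * (norm w)\<^sup>2 / c)"
    using assms by (intro mult_left_mono)
  also have "\<dots> = \<beta> * (norm u)\<^sup>2 + \<beta>\<^sup>2 * ((norm w)\<^sup>2 / c)"
    by (simp add: algebra_simps power2_eq_square)
  also have "\<dots> \<le> \<beta> * (norm u)\<^sup>2 + 1 * ((norm w)\<^sup>2 / c)"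
    using assms c by (intro add_left_mono mult_right_mono power_le_one) auto
  finally show ?thesis by (simp add: c_def norm_scaleR power_mult_distrib mult.assoc[symmetric] flip: power2_eq_square)
qed

text \<open>The smoothness bound is applied to the step \<open>- h (l x + a Q)\<close>. Weight decay
  costs at most \<open>h * \<rho> * norm (g x)\<close>; replacing \<open>M\<close> by
  \<open>g x\<close> in the alignment bound costs \<open>norm (M - g x)\<close> once through the
  norm of \<open>M\<close> and once through \<open>Q\<close>.\<close>

lemma normalized_step_descent:
  fixes f :: "real^'n^'m \<Rightarrow> real" and x x' M :: "real^'n^'m"
  assumes grad: "\<And>Y. GDERIV f Y :> g Y"
    and lip: "\<And>Y Z. norm (g Z - g Y) \<le> L * norm (Z - Y)" and L: "0 \<le> L"
    and x': "x' = (1 - l * h) *\<^sub>R x - (a * h) *\<^sub>R Orth (row_normalize M)"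
    and h: "0 \<le> h" and a: "0 \<le> a" and l: "0 \<le> l" "l * norm x \<le> \<rho>"
  shows "norm (x' - x) \<le> h * (a * sqrt (real CARD('n)) + \<rho>)" (is "_ \<le> h * ?K")
    and "f x' \<le> f x - (a / sqrt (real CARD('m)) - \<rho>) * h * norm (g x)
      + a * h * (1 / sqrt (real CARD('m)) + sqrt (real CARD('n))) * norm (M - g x)
      + L / 2 * (h * (a * sqrt (real CARD('n)) + \<rho>))\<^sup>2"
proof -
  define Q where "Q = Orth (row_normalize M)"
  define n where "n = sqrt (real CARD('n))"
  define m where "m = sqrt (real CARD('m))"
  have m: "0 < m" by (simp add: m_def)
  have Q: "norm Q \<le> n" by (simp add: Q_def n_def norm_Orth_le)
  have diff: "x' - x = - (h *\<^sub>R (l *\<^sub>R x + a *\<^sub>R Q))"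
    by (simp add: x' Q_def algebra_simps)
  have "norm (l *\<^sub>R x + a *\<^sub>R Q) \<le> norm (l *\<^sub>R x) + norm (a *\<^sub>R Q)" by (rule norm_triangle_ineq)
  also have "\<dots> \<le> \<rho> + a * n" using l a Q by (intro add_mono) (auto intro: mult_left_mono)
  finally have "h * norm (l *\<^sub>R x + a *\<^sub>R Q) \<le> h * (a * n + \<rho>)" using h by (intro mult_left_mono) auto
  then show step: "norm (x' - x) \<le> h * ?K" using h by (simp add: diff n_def)
  have "norm (g x) \<le> norm M + norm (M - g x)" using norm_triangle_ineq4[of M "M - g x"] by simp
  then have "norm (g x) / m \<le> norm M / m + norm (M - g x) / m"
    using m by (simp add: add_divide_distrib[symmetric] divide_right_mono)
  also have "norm M / m \<le> M \<bullet> Q" unfolding Q_def m_def by (rule inner_Orth_row_normalize_ge)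
  finally have "norm (g x) / m \<le> g x \<bullet> Q + (M - g x) \<bullet> Q + norm (M - g x) / m"
    by (simp add: inner_diff_left)
  moreover have "(M - g x) \<bullet> Q \<le> norm (M - g x) * n"
    using norm_cauchy_schwarz[of "M - g x" Q] mult_left_mono[OF Q norm_ge_zero, of "M - g x"] by linarith
  ultimately have "norm (g x) / m - (1 / m + n) * norm (M - g x) \<le> g x \<bullet> Q" by (simp add: algebra_simps)
  then have gQ: "(a * h) * (norm (g x) / m - (1 / m + n) * norm (M - g x)) \<le> (a * h) * (g x \<bullet> Q)"
    using a h by (intro mult_left_mono) auto
  have "- (l * (g x \<bullet> x)) \<le> l * (norm (g x) * norm x)"
  proof -
    have "- (g x \<bullet> x) \<le> norm (g x) * norm x" using norm_cauchy_schwarz[of "- g x" x] by simp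
    then have "l * - (g x \<bullet> x) \<le> l * (norm (g x) * norm x)" using l(1) by (rule mult_left_mono)
    then show ?thesis by simp
  qed
  also have "\<dots> \<le> \<rho> * norm (g x)" using mult_right_mono[OF l(2), of "norm (g x)"] by (simp add: mult_ac)
  finally have "h * (- (l * (g x \<bullet> x))) \<le> h * (\<rho> * norm (g x))" using h by (rule mult_left_mono)
  then have "g x \<bullet> (x' - x) \<le> h * \<rho> * norm (g x) - (a * h) * (norm (g x) / m - (1 / m + n) * norm (M - g x))"
    using gQ by (simp add: diff inner_add_right algebra_simps)
  moreover have "f x' \<le> f x + g x \<bullet> (x' - x) + L / 2 * (norm (x' - x))\<^sup>2"
    by (rule gderiv_descent[OF grad lip])
  moreover have "L / 2 * (norm (x' - x))\<^sup>2 \<le> L / 2 * (h * ?K)\<^sup>2"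
    using step L by (intro mult_left_mono power_mono) auto
  ultimately show "f x' \<le> f x - (a / sqrt (real CARD('m)) - \<rho>) * h * norm (g x)
      + a * h * (1 / sqrt (real CARD('m)) + sqrt (real CARD('n))) * norm (M - g x)
      + L / 2 * (h * ?K)\<^sup>2"
    unfolding m_def[symmetric] n_def[symmetric] by (simp add: algebra_simps)
qed

section \<open>Adapted iterates and centered noise\<close>

text \<open>The index sets \<open>{1..<t}\<close> and \<open>{t}\<close> are disjoint, so the two
  restrictions are independent; evaluation at \<open>t\<close> turns the one-factor product into
  \<open>D\<close>. For \<open>t = 1\<close> the past is a single point.\<close>

lemma (in prob_space) indep_vars_past_present_joint:
  fixes \<xi> :: "nat \<Rightarrow> 'a \<Rightarrow> 'z"
  assumes ind: "indep_vars (\<lambda>_. D) \<xi> {1..}" and t: "1 \<le> t" and law: "distr M D (\<xi> t) = D"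
  defines "S \<equiv> PiM {1..<t} (\<lambda>_. D)" and "H \<equiv> (\<lambda>\<omega>. restrict (\<lambda>i. \<xi> i \<omega>) {1..<t})"
  shows "H \<in> measurable M S"
    and "distr M (S \<Otimes>\<^sub>M D) (\<lambda>\<omega>. (H \<omega>, \<xi> t \<omega>)) = distr M S H \<Otimes>\<^sub>M D"
proof -
  have \<xi>t [measurable]: "\<xi> t \<in> measurable M D" using ind t by (auto simp: indep_vars_def)
  define R where "R \<omega> = restrict (\<lambda>i. \<xi> i \<omega>) {t}" for \<omega>
  have "indep_var S H (PiM {t} (\<lambda>_. D)) R"
    unfolding S_def H_def R_def using t by (intro indep_var_restrict[OF ind]) auto
  then have H [measurable]: "H \<in> measurable M S" and R [measurable]: "R \<in> measurable M (PiM {t} (\<lambda>_. D))"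
    and joint: "distr M S H \<Otimes>\<^sub>M distr M (PiM {t} (\<lambda>_. D)) R
      = distr M (S \<Otimes>\<^sub>M PiM {t} (\<lambda>_. D)) (\<lambda>\<omega>. (H \<omega>, R \<omega>))"
    unfolding indep_var_distribution_eq by auto
  show "H \<in> measurable M S" by (rule H)
  have comp [measurable]: "(\<lambda>p. p t) \<in> measurable (PiM {t} (\<lambda>_. D)) D" by simp
  have RD: "distr (distr M (PiM {t} (\<lambda>_. D)) R) D (\<lambda>p. p t) = D"
    by (subst distr_distr) (auto simp: comp_def R_def law)
  interpret D: prob_space D using prob_space_distr[OF \<xi>t] by (simp add: law)
  have "distr M S H \<Otimes>\<^sub>M D = distr (distr M S H) S (\<lambda>x. x)
      \<Otimes>\<^sub>M distr (distr M (PiM {t} (\<lambda>_. D)) R) D (\<lambda>p. p t)"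
    by (simp add: RD distr_id2)
  also have "\<dots> = distr (distr M S H \<Otimes>\<^sub>M distr M (PiM {t} (\<lambda>_. D)) R) (S \<Otimes>\<^sub>M D) (\<lambda>(x, p). (x, p t))"
    by (rule pair_measure_distr) (simp_all add: RD D.sigma_finite_measure_axioms)
  also have "\<dots> = distr M (S \<Otimes>\<^sub>M D) (\<lambda>\<omega>. (H \<omega>, \<xi> t \<omega>))"
    unfolding joint by (subst distr_distr) (simp_all add: comp_def case_prod_unfold, simp add: R_def)
  finally show "distr M (S \<Otimes>\<^sub>M D) (\<lambda>\<omega>. (H \<omega>, \<xi> t \<omega>)) = distr M S H \<Otimes>\<^sub>M D" ..
qed

text \<open>For a fixed past \<open>s\<close> the cross term integrates to zero. Integrating over
  the past with nonnegative integrals yields integrability and the bound at once, and plays the part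
  of conditional expectation.\<close>

lemma (in prob_space) centered_noise_second_moment:
  fixes p :: "'s \<Rightarrow> 'v::euclidean_space" and g :: "'s \<Rightarrow> 'z \<Rightarrow> 'v"
  assumes H [measurable]: "H \<in> measurable M S" and Zm [measurable]: "Z \<in> measurable M D"
    and joint: "distr M (S \<Otimes>\<^sub>M D) (\<lambda>\<omega>. (H \<omega>, Z \<omega>)) = distr M S H \<Otimes>\<^sub>M D"
    and D: "prob_space D"
    and p [measurable]: "p \<in> borel_measurable S"
    and g [measurable]: "(\<lambda>(s, z). g s z) \<in> borel_measurable (S \<Otimes>\<^sub>M D)"
    and g_int: "\<And>s. s \<in> space S \<Longrightarrow> integrable D (g s)"
    and g_mean: "\<And>s. s \<in> space S \<Longrightarrow> (\<integral>z. g s z \<partial>D) = 0"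
    and g_var: "\<And>s. s \<in> space S \<Longrightarrow> integrable D (\<lambda>z. (norm (g s z))\<^sup>2)"
      "\<And>s. s \<in> space S \<Longrightarrow> (\<integral>z. (norm (g s z))\<^sup>2 \<partial>D) \<le> v"
    and p_int: "integrable M (\<lambda>\<omega>. (norm (p (H \<omega>)))\<^sup>2)" and v: "0 \<le> v"
  shows "integrable M (\<lambda>\<omega>. (norm (p (H \<omega>) + c *\<^sub>R g (H \<omega>) (Z \<omega>)))\<^sup>2)" (is "integrable M ?Y")
    and "expectation (\<lambda>\<omega>. (norm (p (H \<omega>) + c *\<^sub>R g (H \<omega>) (Z \<omega>)))\<^sup>2)
      \<le> expectation (\<lambda>\<omega>. (norm (p (H \<omega>)))\<^sup>2) + c\<^sup>2 * v"
proof -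
  interpret D: prob_space D by fact
  have inner: "(\<integral>\<^sup>+ z. ennreal ((norm (p s + c *\<^sub>R g s z))\<^sup>2) \<partial>D) \<le> ennreal ((norm (p s))\<^sup>2 + c\<^sup>2 * v)"
    if s: "s \<in> space S" for s
  proof -
    have eq: "(norm (p s + c *\<^sub>R g s z))\<^sup>2
        = (norm (p s))\<^sup>2 + 2 * c * (p s \<bullet> g s z) + c\<^sup>2 * (norm (g s z))\<^sup>2" for z
      by (rule norm_add_scaleR_sq)
    have int: "integrable D (\<lambda>z. p s \<bullet> g s z)" using g_int[OF s] by simp
    have "(\<integral>z. p s \<bullet> g s z \<partial>D) = 0" using g_int[OF s] g_mean[OF s] by simp
    then have "(\<integral>z. (norm (p s + c *\<^sub>R g s z))\<^sup>2 \<partial>D) = (norm (p s))\<^sup>2 + c\<^sup>2 * (\<integral>z. (norm (g s z))\<^sup>2 \<partial>D)"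
      unfolding eq using int g_var(1)[OF s] by (simp add: D.prob_space)
    also have "\<dots> \<le> (norm (p s))\<^sup>2 + c\<^sup>2 * v" using g_var(2)[OF s] by (intro add_left_mono mult_left_mono) auto
    finally have "(\<integral>z. (norm (p s + c *\<^sub>R g s z))\<^sup>2 \<partial>D) \<le> (norm (p s))\<^sup>2 + c\<^sup>2 * v" .
    moreover have "integrable D (\<lambda>z. (norm (p s + c *\<^sub>R g s z))\<^sup>2)"
      unfolding eq using int g_var(1)[OF s] by simp
    ultimately show ?thesis by (subst nn_integral_eq_integral) (auto simp: ennreal_leI)
  qed
  have Ym: "(\<lambda>(s, z). ennreal ((norm (p s + c *\<^sub>R g s z))\<^sup>2)) \<in> borel_measurable (S \<Otimes>\<^sub>M D)"
    by measurable
  have [measurable]: "?Y \<in> borel_measurable M" by measurable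
  have "(\<integral>\<^sup>+ \<omega>. ennreal (?Y \<omega>) \<partial>M)
      = (\<integral>\<^sup>+ (s, z). ennreal ((norm (p s + c *\<^sub>R g s z))\<^sup>2) \<partial>(distr M (S \<Otimes>\<^sub>M D) (\<lambda>\<omega>. (H \<omega>, Z \<omega>))))"
    using Ym by (subst nn_integral_distr) auto
  also have "\<dots> = (\<integral>\<^sup>+ s. \<integral>\<^sup>+ z. ennreal ((norm (p s + c *\<^sub>R g s z))\<^sup>2) \<partial>D \<partial>distr M S H)"
  proof -
    have "(\<lambda>(s, z). ennreal ((norm (p s + c *\<^sub>R g s z))\<^sup>2)) \<in> borel_measurable (distr M S H \<Otimes>\<^sub>M D)"
      using Ym by (simp cong: measurable_cong_sets)
    from D.nn_integral_fst[OF this] show ?thesis unfolding joint by simp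
  qed
  also have "\<dots> \<le> (\<integral>\<^sup>+ s. ennreal ((norm (p s))\<^sup>2 + c\<^sup>2 * v) \<partial>distr M S H)"
    using inner by (intro nn_integral_mono) simp
  also have "\<dots> = (\<integral>\<^sup>+ \<omega>. ennreal ((norm (p (H \<omega>)))\<^sup>2 + c\<^sup>2 * v) \<partial>M)"
    by (subst nn_integral_distr) auto
  also have "\<dots> = ennreal (expectation (\<lambda>\<omega>. (norm (p (H \<omega>)))\<^sup>2 + c\<^sup>2 * v))"
    using p_int v by (intro nn_integral_eq_integral) auto
  also have "expectation (\<lambda>\<omega>. (norm (p (H \<omega>)))\<^sup>2 + c\<^sup>2 * v) = expectation (\<lambda>\<omega>. (norm (p (H \<omega>)))\<^sup>2) + c\<^sup>2 * v"
    using p_int by (simp add: prob_space)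
  finally have le: "(\<integral>\<^sup>+ \<omega>. ennreal (?Y \<omega>) \<partial>M) \<le> ennreal (expectation (\<lambda>\<omega>. (norm (p (H \<omega>)))\<^sup>2) + c\<^sup>2 * v)" .
  show "integrable M ?Y"
    by (rule integrableI_bounded) (use le in \<open>auto simp: le_less_trans\<close>)
  show "expectation ?Y \<le> expectation (\<lambda>\<omega>. (norm (p (H \<omega>)))\<^sup>2) + c\<^sup>2 * v"
    by (rule integral_real_bounded) (use le v in \<open>auto intro!: add_nonneg_nonneg\<close>)
qed

text \<open>\<open>X t\<close> and \<open>M (t - 1)\<close> are Borel functions of the samples
  before time \<open>t\<close>, by induction through the update maps. Hence the current sample
  \<open>\<xi> t\<close> is independent of both.\<close>

lemma adapted_iterates:
  fixes X M :: "nat \<Rightarrow> 'w \<Rightarrow> 'v::second_countable_topology" and D :: "'d measure"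
  assumes \<Phi>: "\<And>t. (\<lambda>((x, m), z). \<Phi> t x m z) \<in> borel_measurable ((borel \<Otimes>\<^sub>M borel) \<Otimes>\<^sub>M D)"
    and \<Psi>: "\<And>t. (\<lambda>(x, m). \<Psi> t x m) \<in> borel_measurable (borel \<Otimes>\<^sub>M borel)"
    and X1: "\<And>\<omega>. \<omega> \<in> W \<Longrightarrow> X 1 \<omega> = xi" and M0: "\<And>\<omega>. \<omega> \<in> W \<Longrightarrow> M 0 \<omega> = mi"
    and M: "\<And>t \<omega>. 1 \<le> t \<Longrightarrow> \<omega> \<in> W \<Longrightarrow> M t \<omega> = \<Phi> t (X t \<omega>) (M (t - 1) \<omega>) (\<xi> t \<omega>)"
    and X: "\<And>t \<omega>. 1 \<le> t \<Longrightarrow> \<omega> \<in> W \<Longrightarrow> X (t + 1) \<omega> = \<Psi> t (X t \<omega>) (M t \<omega>)"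
    and "1 \<le> t"
  shows "\<exists>hX hM. hX \<in> borel_measurable (PiM {1..<t} (\<lambda>_. D)) \<and> hM \<in> borel_measurable (PiM {1..<t} (\<lambda>_. D)) \<and>
    (\<forall>\<omega>\<in>W. X t \<omega> = hX (restrict (\<lambda>i. \<xi> i \<omega>) {1..<t}) \<and> M (t - 1) \<omega> = hM (restrict (\<lambda>i. \<xi> i \<omega>) {1..<t}))"
  using \<open>1 \<le> t\<close>
proof (induction t rule: nat_induct_at_least)
  case base
  show ?case
    by (rule exI[of _ "\<lambda>_. xi"], rule exI[of _ "\<lambda>_. mi"]) (use X1 M0 in simp)
next
  case (Suc t)
  from Suc.IH obtain hX hM where [measurable]: "hX \<in> borel_measurable (PiM {1..<t} (\<lambda>_. D))"
    and [measurable]: "hM \<in> borel_measurable (PiM {1..<t} (\<lambda>_. D))"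
    and h: "\<forall>\<omega>\<in>W. X t \<omega> = hX (restrict (\<lambda>i. \<xi> i \<omega>) {1..<t}) \<and>
      M (t - 1) \<omega> = hM (restrict (\<lambda>i. \<xi> i \<omega>) {1..<t})"
    by (elim exE conjE) (rule that)
  let ?P = "PiM {1..<Suc t} (\<lambda>_. D)"
  \<comment> \<open>\<open>r\<close> forgets the latest sample, so the earlier representing
    functions can be evaluated on the longer history.\<close>
  define r where "r p = restrict p {1..<t}" for p :: "nat \<Rightarrow> 'd"
  have [measurable]: "r \<in> measurable ?P (PiM {1..<t} (\<lambda>_. D))"
    unfolding r_def[abs_def] by (rule measurable_restrict_subset) auto
  have [measurable]: "(\<lambda>p. p t) \<in> measurable ?P D"
    using Suc.hyps by (intro measurable_component_singleton) auto
  define hM' where "hM' p = \<Phi> t (hX (r p)) (hM (r p)) (p t)" for p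
  define hX' where "hX' p = \<Psi> t (hX (r p)) (hM' p)" for p
  have hM': "hM' \<in> borel_measurable ?P"
  proof -
    have "(\<lambda>p. ((hX (r p), hM (r p)), p t)) \<in> measurable ?P ((borel \<Otimes>\<^sub>M borel) \<Otimes>\<^sub>M D)" by measurable
    from measurable_compose[OF this \<Phi>[of t]] show ?thesis by (simp add: hM'_def[abs_def])
  qed
  then have "(\<lambda>p. (hX (r p), hM' p)) \<in> measurable ?P (borel \<Otimes>\<^sub>M borel)" by measurable
  from measurable_compose[OF this \<Psi>[of t]] have "hX' \<in> borel_measurable ?P" by (simp add: hX'_def[abs_def])
  moreover have "X (Suc t) \<omega> = hX' (restrict (\<lambda>i. \<xi> i \<omega>) {1..<Suc t}) \<and>
      M (Suc t - 1) \<omega> = hM' (restrict (\<lambda>i. \<xi> i \<omega>) {1..<Suc t})" if "\<omega> \<in> W" for \<omega>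
  proof -
    let ?p = "restrict (\<lambda>i. \<xi> i \<omega>) {1..<Suc t}"
    have "r ?p = restrict (\<lambda>i. \<xi> i \<omega>) {1..<t}" by (auto simp: r_def restrict_def fun_eq_iff)
    moreover have "?p t = \<xi> t \<omega>" using Suc.hyps by simp
    ultimately have "M t \<omega> = hM' ?p" "X t \<omega> = hX (r ?p)"
      using M[OF Suc.hyps that] bspec[OF h that] by (simp_all only: hM'_def)
    then show ?thesis using X[OF Suc.hyps that] by (simp only: hX'_def Suc_eq_plus1 add_diff_cancel_right' simp_thms)
  qed
  ultimately show ?case using hM' by blast
qed

text \<open>The factor \<open>1 - l t\<close> lies in \<open>[0, 1]\<close>, so only the lengths of
  the \<open>Q\<close> steps accumulate. Since \<open>t powr (1/4)\<close> is at least 1, it also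
  absorbs the initial norm.\<close>

lemma iterate_norm_le:
  fixes X Q :: "nat \<Rightarrow> 'v::real_normed_vector"
  assumes X: "\<And>t. 1 \<le> t \<Longrightarrow> X (t + 1) = (1 - l t) *\<^sub>R X t - (a * h t) *\<^sub>R Q t"
    and l: "\<And>t. 1 \<le> t \<Longrightarrow> 0 \<le> l t" "\<And>t. 1 \<le> t \<Longrightarrow> l t \<le> 1"
    and h: "\<And>t. 1 \<le> t \<Longrightarrow> h t = real t powr (-(3/4))"
    and a: "0 \<le> a" and Q: "\<And>t. 1 \<le> t \<Longrightarrow> norm (Q t) \<le> q" and q: "0 \<le> q" and t: "1 \<le> t"
  shows "norm (X t) \<le> (norm (X 1) + 4 * a * q) * real t powr (1/4)"
proof -
  have "norm (X (Suc n)) \<le> norm (X 1) + a * q * (\<Sum>s=1..n. real s powr (-(3/4)))" for n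
  proof (induction n)
    case (Suc n)
    let ?k = "Suc n"
    have "norm (X (Suc ?k)) \<le> norm ((1 - l ?k) *\<^sub>R X ?k) + norm ((a * h ?k) *\<^sub>R Q ?k)"
      using X[of ?k] norm_triangle_ineq4[of "(1 - l ?k) *\<^sub>R X ?k" "(a * h ?k) *\<^sub>R Q ?k"]
      by (simp del: norm_scaleR)
    also have "\<dots> \<le> 1 * norm (X ?k) + (a * h ?k) * q"
    proof (rule add_mono)
      show "norm ((1 - l ?k) *\<^sub>R X ?k) \<le> 1 * norm (X ?k)"
        using l[of ?k] unfolding norm_scaleR by (intro mult_right_mono) auto
      show "norm ((a * h ?k) *\<^sub>R Q ?k) \<le> (a * h ?k) * q"
        using a h[of ?k] Q[of ?k] by (auto intro!: mult_left_mono)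
    qed
    finally show ?case using Suc h[of ?k] by (simp add: algebra_simps)
  qed simp
  from this[of "t - 1"] have "norm (X t) \<le> norm (X 1) + a * q * (\<Sum>s=1..t-1. real s powr (-(3/4)))"
    using t by simp
  also have "\<dots> \<le> norm (X 1) * real t powr (1/4) + a * q * (4 * real t powr (1/4))"
  proof (intro add_mono mult_left_mono)
    have "1 \<le> real t powr (1/4)" using t by (simp add: ge_one_powr_ge_zero)
    then show "norm (X 1) \<le> norm (X 1) * real t powr (1/4)"
      using mult_left_mono[of 1 "real t powr (1/4)" "norm (X 1)"] by simp
    have "real (t - 1) powr (1/4) \<le> real t powr (1/4)" by (intro powr_mono2) auto
    then show "(\<Sum>s=1..t-1. real s powr (-(3/4))) \<le> 4 * real t powr (1/4)"
      using sum_powr_three_quarters_le[of "t - 1"] by linarith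
  qed (use a q in auto)
  finally show ?thesis by (simp add: algebra_simps)
qed

text \<open>With \<open>x = t powr (1/4)\<close>, this is
  \<open>(L * c - \<epsilon> * x)^2 \<ge> 0\<close> divided by \<open>L * x^4\<close>. The weights
  \<open>1 / t\<close> and \<open>1 / sqrt t\<close> are those of the harmonic sum and of the
  momentum error sum.\<close>

lemma young_stepsize:
  assumes t: "1 \<le> (t::nat)" and L: "0 < L"
  shows "real t powr (-(3/4)) * c * \<epsilon> \<le> (L * c\<^sup>2 * (1 / real t) + \<epsilon>\<^sup>2 / sqrt (real t) / L) / 2"
proof -
  obtain x where x: "0 < x" "real t = x ^ 4" "sqrt (real t) = x\<^sup>2"
    "real t powr (-(3/4)) = 1 / x ^ 3" using obtain_root4[OF t] by metis
  have "0 \<le> (L * c - \<epsilon> * x)\<^sup>2 / (L * x ^ 4)" using L by simp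
  also have "\<dots> = L * c\<^sup>2 * (1 / x ^ 4) + \<epsilon>\<^sup>2 / x\<^sup>2 / L - 2 * (1 / x ^ 3 * c * \<epsilon>)"
    using L x(1) by (simp add: field_simps power2_eq_square power3_eq_cube power4_eq_xxxx)
  finally show ?thesis unfolding x(3,4) unfolding x(2) by (simp add: mult_ac)
qed

section \<open>Convergence rate\<close>

theorem theorem3p5:
  fixes f :: "real^'n^'m \<Rightarrow> real"
    and gradf :: "real^'n^'m \<Rightarrow> real^'n^'m"
    and F :: "real^'n^'m \<Rightarrow> 'z \<Rightarrow> real"
    and gradF :: "real^'n^'m \<Rightarrow> 'z \<Rightarrow> real^'n^'m"
    and D :: "'z measure" and \<Omega> :: "'w measure"
    and \<xi> :: "nat \<Rightarrow> 'w \<Rightarrow> 'z"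
    and X Mom G Omat :: "nat \<Rightarrow> 'w \<Rightarrow> real^'n^'m"
    and X1 :: "real^'n^'m"
    and \<eta> \<beta> lam :: "nat \<Rightarrow> real"
    and fstar L \<sigma> \<rho> a C1 C2 :: real
    and T :: nat
  assumes dims: "CARD('n) \<le> CARD('m)"
    \<comment> \<open>the objective and its stochastic gradients\<close>
    and prob_D: "prob_space D"
    and F_integrable: "\<And>Y. integrable D (F Y)"
    and f_eq: "\<And>Y. f Y = (\<integral>z. F Y z \<partial>D)"
    and f_grad: "\<And>Y. GDERIV f Y :> gradf Y"
    and F_grad: "\<And>Y z. z \<in> space D \<Longrightarrow> GDERIV (\<lambda>Z. F Z z) Y :> gradF Y z"
    and f_bdd: "\<And>Y. fstar \<le> f Y"
    and L_pos: "0 < L"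
    and f_smooth: "\<And>Y Z. norm (gradf Z - gradf Y) \<le> L * norm (Z - Y)"
    and \<sigma>_pos: "0 < \<sigma>"
    and unbiased: "\<And>Y. integrable D (gradF Y)" "\<And>Y. (\<integral>z. gradF Y z \<partial>D) = gradf Y"
    and variance: "\<And>Y. integrable D (\<lambda>z. (norm (gradF Y z - gradf Y))\<^sup>2)"
      "\<And>Y. (\<integral>z. (norm (gradF Y z - gradf Y))\<^sup>2 \<partial>D) \<le> \<sigma>\<^sup>2"
    \<comment> \<open>i.i.d. samples with law \<open>D\<close>\<close>
    and prob_\<Omega>: "prob_space \<Omega>"
    and \<xi>_indep: "prob_space.indep_vars \<Omega> (\<lambda>_. D) \<xi> {1..}"
    and \<xi>_distr: "\<And>t. 1 \<le> t \<Longrightarrow> distr \<Omega> D (\<xi> t) = D"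
    \<comment> \<open>parameters\<close>
    and \<eta>_eq: "\<And>t. 1 \<le> t \<Longrightarrow> \<eta> t = real t powr (- (3/4))"
    and \<beta>_eq: "\<And>t. 1 \<le> t \<Longrightarrow> \<beta> t = 1 - real t powr (- (1/2))"
    and a_eq: "a = 0.2 * sqrt (real (max CARD('m) CARD('n)))"
    and \<rho>_bounds: "0 \<le> \<rho>" "\<rho> < a / sqrt (real CARD('m))"
    and lam_bounds: "\<And>t. 1 \<le> t \<Longrightarrow> 0 \<le> lam t"
      "\<And>t. 1 \<le> t \<Longrightarrow>
         lam t \<le> \<rho> / (norm X1 + 4 * a * sqrt (real CARD('n))) * real t powr (- (1/4))"
    \<comment> \<open>the iterates\<close>
    and X_init: "\<And>\<omega>. \<omega> \<in> space \<Omega> \<Longrightarrow> X 1 \<omega> = X1"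
    and Mom_init: "\<And>\<omega>. \<omega> \<in> space \<Omega> \<Longrightarrow> Mom 0 \<omega> = 0"
    and G_eq: "\<And>t \<omega>. 1 \<le> t \<Longrightarrow> \<omega> \<in> space \<Omega> \<Longrightarrow> G t \<omega> = gradF (X t \<omega>) (\<xi> t \<omega>)"
    and Mom_step: "\<And>t \<omega>. 1 \<le> t \<Longrightarrow> \<omega> \<in> space \<Omega> \<Longrightarrow>
         Mom t \<omega> = \<beta> t *\<^sub>R Mom (t - 1) \<omega> + (1 - \<beta> t) *\<^sub>R G t \<omega>"
    and O_eq: "\<And>t \<omega>. 1 \<le> t \<Longrightarrow> \<omega> \<in> space \<Omega> \<Longrightarrow> Omat t \<omega> = Orth (row_normalize (Mom t \<omega>))"
    and X_step: "\<And>t \<omega>. 1 \<le> t \<Longrightarrow> \<omega> \<in> space \<Omega> \<Longrightarrow>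
         X (t + 1) \<omega> = (1 - lam t * \<eta> t) *\<^sub>R X t \<omega> - (a * \<eta> t) *\<^sub>R Omat t \<omega>"
    \<comment> \<open>the constants of the bound\<close>
    and C1_eq: "C1 = a / L * (2 * sqrt 2 * L\<^sup>2 * (a * sqrt (real CARD('n)) + \<rho>)\<^sup>2 + \<sigma>\<^sup>2)
           + a * L * (1 / sqrt (real CARD('m)) + sqrt (real CARD('n)))\<^sup>2"
    and C2_eq: "C2 = a * \<sigma>\<^sup>2 / L + 3 * L / 2 * (a * sqrt (real CARD('n)) + \<rho>)\<^sup>2"
    and T_pos: "1 \<le> T"
  shows "(\<forall>t\<in>{1..T}. integrable \<Omega> (\<lambda>\<omega>. norm (gradf (X t \<omega>)))) \<and>
    1 / real T * (\<Sum>t=1..T. \<integral>\<omega>. norm (gradf (X t \<omega>)) \<partial>\<Omega>)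
      \<le> (f X1 - fstar + C1 * (1 + ln (real T)) + C2)
          / ((a / sqrt (real CARD('m)) - \<rho>) * real T powr (1/4))"
proof -

  \<comment> \<open>Constants and descent along each path\<close>
  interpret prob_space \<Omega> by fact
  let ?W = "space \<Omega>"
  define n where "n = sqrt (real CARD('n))"
  define m where "m = sqrt (real CARD('m))"
  define K where "K = a * n + \<rho>"
  define \<kappa> where "\<kappa> = a / m - \<rho>"
  define c where "c = 1 / m + n"
  define P where "P = L\<^sup>2 * K\<^sup>2"
  define B where "B = norm X1 + 4 * a * n"
  define Er where "Er t \<omega> = Mom t \<omega> - gradf (X t \<omega>)" for t \<omega>
  define e where "e t = (\<integral>\<omega>. (norm (Er t \<omega>))\<^sup>2 \<partial>\<Omega>)" for t
  have n: "1 \<le> n" and m: "1 \<le> m" by (simp_all add: n_def m_def)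
  have a: "0 < a" unfolding a_eq by (simp add: max_def)
  have \<kappa>: "0 < \<kappa>" using \<rho>_bounds by (simp add: \<kappa>_def m_def)
  have K: "0 \<le> K" using a n \<rho>_bounds by (simp add: K_def)
  have P: "0 \<le> P" by (simp add: P_def)
  have "a * 1 \<le> a * n" "0 < a * n" using a n by (auto intro: mult_left_mono)
  moreover have "\<rho> < a" using \<rho>_bounds(2) a m frac_le[of a a 1 m] by (simp add: m_def)
  \<comment> \<open>\<open>\<rho> < a \<le> 4 * a * n \<le> B\<close> bounds
    \<open>\<rho> / B\<close> by 1, so that \<open>lam t * \<eta> t \<le> 1\<close>.\<close>
  ultimately have B: "0 < B" "\<rho> \<le> B" unfolding B_def using norm_ge_zero[of X1] by linarith+
  have \<beta>: "\<beta> t = 1 - 1 / sqrt (real t)" if "1 \<le> t" for t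
    using \<beta>_eq[OF that] by (simp add: powr_minus_divide powr_half_sqrt)
  have \<beta>_bounds: "0 \<le> \<beta> t" "\<beta> t < 1" if "1 \<le> t" for t
    using that by (auto simp: \<beta> divide_simps)
  have \<beta>1: "\<beta> 1 = 0" by (simp add: \<beta>)
  have \<eta>_pos: "0 < \<eta> t" if "1 \<le> t" for t using that by (simp add: \<eta>_eq)
  have lam\<eta>: "lam t * \<eta> t \<le> 1" if t: "1 \<le> t" for t
  proof -
    have pw: "real t powr (-(1/4)) \<le> 1" "real t powr (-(3/4)) \<le> 1"
      using powr_mono[of "-(1/4)" 0 "real t"] powr_mono[of "-(3/4)" 0 "real t"] t by auto
    have "lam t \<le> \<rho> / B * real t powr (-(1/4))" using lam_bounds(2)[OF t] by (simp add: B_def n_def)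
    also have "\<dots> \<le> 1 * 1" using B \<rho>_bounds(1) pw by (intro mult_mono) auto
    finally show ?thesis using lam_bounds(1)[OF t] \<eta>_eq[OF t] pw mult_mono[of "lam t" 1 "\<eta> t" 1] by simp
  qed
  \<comment> \<open>The possible growth of the iterates like \<open>t powr (1/4)\<close> is
    cancelled by the decay of \<open>lam\<close>.\<close>
  have lamX: "lam t * norm (X t \<omega>) \<le> \<rho>" and X_bdd: "norm (X t \<omega>) \<le> B * real t powr (1/4)"
    if t: "1 \<le> t" and \<omega>: "\<omega> \<in> ?W" for t \<omega>
  proof -
    have "norm (X t \<omega>) \<le> (norm (X 1 \<omega>) + 4 * a * n) * real t powr (1/4)"
      by (rule iterate_norm_le[where l = "\<lambda>t. lam t * \<eta> t" and h = \<eta> and Q = "\<lambda>t. Omat t \<omega>"])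
        (use X_step \<omega> lam\<eta> lam_bounds \<eta>_eq a n t in
          \<open>auto simp: O_eq n_def norm_Orth_le\<close>)
    then show le: "norm (X t \<omega>) \<le> B * real t powr (1/4)" using X_init[OF \<omega>] by (simp add: B_def)
    obtain x where x: "0 < x" "real t powr (1/4) = x" "real t powr (-(1/4)) = 1 / x"
      using obtain_root4[OF t] by metis
    have "lam t * norm (X t \<omega>) \<le> (\<rho> / B * (1 / x)) * (B * x)"
      using lam_bounds[OF t] le x B \<rho>_bounds(1)
      by (intro mult_mono) (auto simp: B_def n_def)
    also have "\<dots> = \<rho>" using B x(1) by simp
    finally show "lam t * norm (X t \<omega>) \<le> \<rho>" .
  qed
  have step: "norm (X (t + 1) \<omega> - X t \<omega>) \<le> \<eta> t * K"
    "f (X (t + 1) \<omega>) \<le> f (X t \<omega>) - \<kappa> * \<eta> t * norm (gradf (X t \<omega>))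
      + a * \<eta> t * c * norm (Er t \<omega>) + L / 2 * (\<eta> t * K)\<^sup>2"
    if t: "1 \<le> t" and \<omega>: "\<omega> \<in> ?W" for t \<omega>
  proof -
    have x': "X (t + 1) \<omega> = (1 - lam t * \<eta> t) *\<^sub>R X t \<omega> - (a * \<eta> t) *\<^sub>R Orth (row_normalize (Mom t \<omega>))"
      using X_step[OF t \<omega>] O_eq[OF t \<omega>] by simp
    note descent = normalized_step_descent[OF f_grad f_smooth less_imp_le[OF L_pos] x'
        less_imp_le[OF \<eta>_pos[OF t]] less_imp_le[OF a] lam_bounds(1)[OF t] lamX[OF t \<omega>]]
    show "norm (X (t + 1) \<omega> - X t \<omega>) \<le> \<eta> t * K"
      using descent(1) by (simp add: K_def n_def)
    show "f (X (t + 1) \<omega>) \<le> f (X t \<omega>) - \<kappa> * \<eta> t * norm (gradf (X t \<omega>))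
      + a * \<eta> t * c * norm (Er t \<omega>) + L / 2 * (\<eta> t * K)\<^sup>2"
      using descent(2) by (simp add: K_def n_def m_def \<kappa>_def c_def Er_def)
  qed

  \<comment> \<open>Measurability and adaptedness of the iterates\<close>
  have "L-lipschitz_on UNIV gradf"
    using f_smooth L_pos by (auto simp: lipschitz_on_def dist_norm)
  then have gradf_meas [measurable]: "gradf \<in> borel_measurable borel"
    by (intro borel_measurable_continuous_onI lipschitz_on_continuous_on)
  have gradF_meas: "(\<lambda>(y, z). gradF y z) \<in> borel_measurable (borel \<Otimes>\<^sub>M D)"
    by (rule measurable_gradient_Caratheodory[where F = F])
      (use F_integrable F_grad in \<open>auto intro: borel_measurable_integrable\<close>)
  have \<Phi>: "(\<lambda>((x, M), z). \<beta> t *\<^sub>R M + (1 - \<beta> t) *\<^sub>R gradF x z)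
      \<in> borel_measurable ((borel \<Otimes>\<^sub>M borel) \<Otimes>\<^sub>M D)" for t
  proof -
    have "(\<lambda>p. (fst (fst p), snd p)) \<in> measurable ((borel \<Otimes>\<^sub>M borel) \<Otimes>\<^sub>M D) (borel \<Otimes>\<^sub>M D)"
      by measurable
    from measurable_compose[OF this gradF_meas]
    have [measurable]: "(\<lambda>p. gradF (fst (fst p)) (snd p)) \<in> borel_measurable ((borel \<Otimes>\<^sub>M borel) \<Otimes>\<^sub>M D)"
      by simp
    show ?thesis unfolding case_prod_unfold by measurable
  qed
  have \<Psi>: "(\<lambda>(x, M). (1 - lam t * \<eta> t) *\<^sub>R x - (a * \<eta> t) *\<^sub>R Orth (row_normalize M))
      \<in> borel_measurable (borel \<Otimes>\<^sub>M (borel :: (real^'n^'m) measure))" for t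
    by measurable
  define past where "past t \<omega> = restrict (\<lambda>i. \<xi> i \<omega>) {1..<t}" for t \<omega>
  define past_space where "past_space t = PiM {1..<t} (\<lambda>_. D)" for t :: nat
  have adapted: "\<exists>hX hM. hX \<in> borel_measurable (past_space t) \<and>
      hM \<in> borel_measurable (past_space t) \<and>
      (\<forall>\<omega>\<in>?W. X t \<omega> = hX (past t \<omega>) \<and>
        Mom (t - 1) \<omega> = hM (past t \<omega>))" if t: "1 \<le> t" for t
    unfolding past_def past_space_def
    by (rule adapted_iterates[where xi = X1 and mi = 0
          and \<Phi> = "\<lambda>t x M z. \<beta> t *\<^sub>R M + (1 - \<beta> t) *\<^sub>R gradF x z"
          and \<Psi> = "\<lambda>t x M. (1 - lam t * \<eta> t) *\<^sub>R x - (a * \<eta> t) *\<^sub>R Orth (row_normalize M)"])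
      (use \<Phi> \<Psi> X_init Mom_init Mom_step G_eq X_step O_eq t in simp_all)
  have past_meas: "(past t) \<in> measurable \<Omega> (past_space t)"
    and joint: "distr \<Omega> (past_space t \<Otimes>\<^sub>M D) (\<lambda>\<omega>. (past t \<omega>, \<xi> t \<omega>))
      = distr \<Omega> (past_space t) (past t) \<Otimes>\<^sub>M D"
    if t: "1 \<le> t" for t
    unfolding past_def[abs_def] past_space_def
    using indep_vars_past_present_joint[OF \<xi>_indep t \<xi>_distr[OF t]] by auto
  have X_meas: "X t \<in> borel_measurable \<Omega>" and Mom_meas: "Mom (t - 1) \<in> borel_measurable \<Omega>"
    if t: "1 \<le> t" for t
  proof -
    obtain hX hM where hX: "hX \<in> borel_measurable (past_space t)"
      and hM: "hM \<in> borel_measurable (past_space t)"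
      and h: "\<forall>\<omega>\<in>?W. X t \<omega> = hX (past t \<omega>) \<and>
        Mom (t - 1) \<omega> = hM (past t \<omega>)"
      using adapted[OF t] by (elim exE conjE) (rule that)
    show "X t \<in> borel_measurable \<Omega>"
      by (rule measurable_cong[THEN iffD2, OF _ measurable_compose[OF past_meas[OF t] hX]]) (use h in blast)
    show "Mom (t - 1) \<in> borel_measurable \<Omega>"
      by (rule measurable_cong[THEN iffD2, OF _ measurable_compose[OF past_meas[OF t] hM]]) (use h in blast)
  qed

  \<comment> \<open>Recursion for the mean square momentum error\<close>
  have noise: "integrable \<Omega> (\<lambda>\<omega>. (norm (Er t \<omega>))\<^sup>2)"
    "e t \<le> (\<integral>\<omega>. (norm (\<beta> t *\<^sub>R (Mom (t - 1) \<omega> - gradf (X t \<omega>))))\<^sup>2 \<partial>\<Omega>) + (1 - \<beta> t)\<^sup>2 * \<sigma>\<^sup>2"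
    if t: "1 \<le> t"
      and int: "integrable \<Omega> (\<lambda>\<omega>. (norm (\<beta> t *\<^sub>R (Mom (t - 1) \<omega> - gradf (X t \<omega>))))\<^sup>2)" for t
  proof -
    obtain hX hM where [measurable]: "hX \<in> borel_measurable (past_space t)"
      and [measurable]: "hM \<in> borel_measurable (past_space t)"
      and hh: "\<forall>\<omega>\<in>?W. X t \<omega> = hX (past t \<omega>) \<and> Mom (t - 1) \<omega> = hM (past t \<omega>)"
      using adapted[OF t] by (elim exE conjE) (rule that)
    have h: "X t \<omega> = hX (past t \<omega>)" "Mom (t - 1) \<omega> = hM (past t \<omega>)" if "\<omega> \<in> ?W" for \<omega>
      using hh that by blast+
    define p where "p s = \<beta> t *\<^sub>R (hM s - gradf (hX s))" for s
    define g where "g s z = gradF (hX s) z - gradf (hX s)" for s z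
    have p: "p \<in> borel_measurable (past_space t)" unfolding p_def[abs_def] by measurable
    have g: "(\<lambda>(s, z). g s z) \<in> borel_measurable ((past_space t) \<Otimes>\<^sub>M D)"
    proof -
      have "(\<lambda>q. (hX (fst q), snd q)) \<in> measurable ((past_space t) \<Otimes>\<^sub>M D) (borel \<Otimes>\<^sub>M D)" by measurable
      from measurable_compose[OF this gradF_meas]
      have [measurable]: "(\<lambda>q. gradF (hX (fst q)) (snd q)) \<in> borel_measurable ((past_space t) \<Otimes>\<^sub>M D)" by simp
      show ?thesis unfolding g_def case_prod_unfold by measurable
    qed
    have pH: "p (past t \<omega>) = \<beta> t *\<^sub>R (Mom (t - 1) \<omega> - gradf (X t \<omega>))" if "\<omega> \<in> ?W" for \<omega>
      using h[OF that] by (simp add: p_def)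
    \<comment> \<open>The error splits into a part determined by the past and the fresh centered
      noise, so their mean squares add.\<close>
    have Er: "Er t \<omega> = p (past t \<omega>) + (1 - \<beta> t) *\<^sub>R g (past t \<omega>) (\<xi> t \<omega>)" if "\<omega> \<in> ?W" for \<omega>
      using Mom_step[OF t that] G_eq[OF t that] pH[OF that] h(1)[OF that]
      by (simp add: Er_def g_def algebra_simps)
    have p_int: "integrable \<Omega> (\<lambda>\<omega>. (norm (p (past t \<omega>)))\<^sup>2)"
      using int by (subst Bochner_Integration.integrable_cong[OF refl]) (auto simp: pH)
    interpret D: prob_space D by fact
    have \<xi>t: "\<xi> t \<in> measurable \<Omega> D" using \<xi>_indep t by (auto simp: indep_vars_def)
    note moment = centered_noise_second_moment[OF past_meas[OF t] \<xi>t joint[OF t] prob_D p g, of "\<sigma>\<^sup>2" "1 - \<beta> t"]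
    have prems: "integrable D (g s)" "(\<integral>z. g s z \<partial>D) = 0" "integrable D (\<lambda>z. (norm (g s z))\<^sup>2)"
      "(\<integral>z. (norm (g s z))\<^sup>2 \<partial>D) \<le> \<sigma>\<^sup>2" for s
      using unbiased variance by (simp_all add: g_def[abs_def] D.prob_space)
    note moment = moment[OF prems p_int zero_le_power2]
    show "integrable \<Omega> (\<lambda>\<omega>. (norm (Er t \<omega>))\<^sup>2)"
      using moment(1) by (subst Bochner_Integration.integrable_cong[OF refl]) (auto simp: Er)
    have "e t = (\<integral>\<omega>. (norm (p (past t \<omega>) + (1 - \<beta> t) *\<^sub>R g (past t \<omega>) (\<xi> t \<omega>)))\<^sup>2 \<partial>\<Omega>)"
      unfolding e_def by (intro Bochner_Integration.integral_cong) (auto simp: Er)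
    also have "\<dots> \<le> (\<integral>\<omega>. (norm (p (past t \<omega>)))\<^sup>2 \<partial>\<Omega>) + (1 - \<beta> t)\<^sup>2 * \<sigma>\<^sup>2" by (rule moment(2))
    also have "(\<integral>\<omega>. (norm (p (past t \<omega>)))\<^sup>2 \<partial>\<Omega>) = (\<integral>\<omega>. (norm (\<beta> t *\<^sub>R (Mom (t - 1) \<omega> - gradf (X t \<omega>))))\<^sup>2 \<partial>\<Omega>)"
      by (intro Bochner_Integration.integral_cong) (auto simp: pH)
    finally show "e t \<le> (\<integral>\<omega>. (norm (\<beta> t *\<^sub>R (Mom (t - 1) \<omega> - gradf (X t \<omega>))))\<^sup>2 \<partial>\<Omega>) + (1 - \<beta> t)\<^sup>2 * \<sigma>\<^sup>2" .
  qed
  have drift: "integrable \<Omega> (\<lambda>\<omega>. (norm (\<beta> (Suc t) *\<^sub>R (Mom t \<omega> - gradf (X (Suc t) \<omega>))))\<^sup>2) \<and>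
      (\<integral>\<omega>. (norm (\<beta> (Suc t) *\<^sub>R (Mom t \<omega> - gradf (X (Suc t) \<omega>))))\<^sup>2 \<partial>\<Omega>)
        \<le> \<beta> (Suc t) * e t + P * (\<eta> t)\<^sup>2 / (1 - \<beta> (Suc t))"
    if t: "1 \<le> t" and int: "integrable \<Omega> (\<lambda>\<omega>. (norm (Er t \<omega>))\<^sup>2)" for t
  proof -
    let ?b = "\<beta> (Suc t)"
    let ?Y = "\<lambda>\<omega>. (norm (?b *\<^sub>R (Mom t \<omega> - gradf (X (Suc t) \<omega>))))\<^sup>2"
    let ?Z = "\<lambda>\<omega>. ?b * (norm (Er t \<omega>))\<^sup>2 + P * (\<eta> t)\<^sup>2 / (1 - ?b)"
    have b: "0 \<le> ?b" "?b < 1" using \<beta>_bounds[of "Suc t"] by auto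
    have le: "?Y \<omega> \<le> ?Z \<omega>" if \<omega>: "\<omega> \<in> ?W" for \<omega>
    proof -
      \<comment> \<open>The drift \<open>w\<close> of the gradient over one step has norm at most
        \<open>L * \<eta> t * K\<close>.\<close>
      define w where "w = gradf (X t \<omega>) - gradf (X (Suc t) \<omega>)"
      have "norm w \<le> L * norm (X t \<omega> - X (Suc t) \<omega>)" unfolding w_def by (rule f_smooth)
      also have "\<dots> \<le> L * (\<eta> t * K)"
        using step(1)[OF t \<omega>] L_pos by (simp add: norm_minus_commute)
      finally have "(norm w)\<^sup>2 \<le> (L * (\<eta> t * K))\<^sup>2" by (intro power_mono) auto
      also have "\<dots> = P * (\<eta> t)\<^sup>2" by (simp add: P_def power_mult_distrib)
      finally have "(norm w)\<^sup>2 / (1 - ?b) \<le> P * (\<eta> t)\<^sup>2 / (1 - ?b)" using b by (simp add: divide_right_mono)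
      moreover have "Mom t \<omega> - gradf (X (Suc t) \<omega>) = Er t \<omega> + w" by (simp add: Er_def w_def)
      ultimately show ?thesis using convex_combination_norm_sq_le[OF b, of "Er t \<omega>" w] by simp
    qed
    have intZ: "integrable \<Omega> ?Z" using int by simp
    have [measurable]: "X (Suc t) \<in> borel_measurable \<Omega>" "Mom t \<in> borel_measurable \<Omega>"
      using X_meas[of "Suc t"] Mom_meas[of "Suc t"] by auto
    have intY: "integrable \<Omega> ?Y"
    proof (rule Bochner_Integration.integrable_bound[OF intZ])
      show "?Y \<in> borel_measurable \<Omega>" by measurable
      show "AE \<omega> in \<Omega>. norm (?Y \<omega>) \<le> norm (?Z \<omega>)"
        using le by (intro AE_I2) (smt (verit) real_norm_def zero_le_power2)
    qed
    have "(\<integral>\<omega>. ?Y \<omega> \<partial>\<Omega>) \<le> (\<integral>\<omega>. ?Z \<omega> \<partial>\<Omega>)" by (rule integral_mono[OF intY intZ le])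
    also have "\<dots> = ?b * e t + P * (\<eta> t)\<^sup>2 / (1 - ?b)" using int by (simp add: e_def prob_space)
    finally show ?thesis using intY by simp
  qed
  \<comment> \<open>\<open>drift\<close> and \<open>noise\<close> alternate. At \<open>t = 1\<close>
    the coefficient \<open>\<beta> 1 = 0\<close> removes the past, so the induction starts from a
    zero integrand.\<close>
  have Er_int: "integrable \<Omega> (\<lambda>\<omega>. (norm (Er t \<omega>))\<^sup>2)" if "1 \<le> t" for t
    using that
  proof (induction t rule: nat_induct_at_least)
    case base
    show ?case by (rule noise) (simp_all add: \<beta>1[simplified])
  next
    case (Suc t)
    then show ?case using drift[OF Suc.hyps] by (intro noise) auto
  qed
  have e1: "e 1 \<le> \<sigma>\<^sup>2" using noise(2)[of 1] by (simp add: \<beta>1[simplified])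
  \<comment> \<open>Here \<open>1 / (1 - \<beta> (Suc t)) = sqrt (Suc t)\<close> and
    \<open>(1 - \<beta> (Suc t))^2 = 1 / Suc t\<close>.\<close>
  have e_rec: "e (Suc t) \<le> (1 - 1 / sqrt (real (Suc t))) * e t
      + sqrt (real (Suc t)) * (P * (real t powr (-(3/4)))\<^sup>2) + \<sigma>\<^sup>2 / real (Suc t)" if t: "1 \<le> t" for t
    using noise(2)[of "Suc t"] drift[OF t Er_int[OF t]] t
    by (simp add: \<beta> \<eta>_eq power_divide mult.commute)
  have e_sum: "(\<Sum>t=1..T. e t / sqrt (real t)) \<le> sqrt 2 * (\<sigma>\<^sup>2 + (sqrt 2 * P + \<sigma>\<^sup>2) * (1 + ln (real T)))"
    by (rule weighted_error_sum_le[where e = e, OF _ e1 P _ e_rec T_pos]) (auto simp: e_def)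

  \<comment> \<open>Summation along a path and expectation\<close>
  have grad_int: "integrable \<Omega> (\<lambda>\<omega>. norm (gradf (X t \<omega>)))" if t: "1 \<le> t" for t
  proof (rule integrable_const_bound)
    have [measurable]: "X t \<in> borel_measurable \<Omega>" by (rule X_meas[OF t])
    show "(\<lambda>\<omega>. norm (gradf (X t \<omega>))) \<in> borel_measurable \<Omega>" by measurable
    show "AE \<omega> in \<Omega>. norm (norm (gradf (X t \<omega>))) \<le> norm (gradf 0) + L * (B * real t powr (1/4))"
    proof (rule AE_I2)
      fix \<omega> assume \<omega>: "\<omega> \<in> ?W"
      have "norm (gradf (X t \<omega>)) \<le> norm (gradf 0) + norm (gradf (X t \<omega>) - gradf 0)"
        using norm_triangle_ineq[of "gradf 0" "gradf (X t \<omega>) - gradf 0"] by simp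
      also have "\<dots> \<le> norm (gradf 0) + L * norm (X t \<omega>)" using f_smooth[of "X t \<omega>" 0] by simp
      also have "\<dots> \<le> norm (gradf 0) + L * (B * real t powr (1/4))"
        using X_bdd[OF t \<omega>] L_pos by simp
      finally show "norm (norm (gradf (X t \<omega>))) \<le> norm (gradf 0) + L * (B * real t powr (1/4))" by simp
    qed
  qed
  define H where "H = (\<Sum>t=1..T. 1 / real t)"
  have H: "H \<le> 1 + ln (real T)" unfolding H_def by (rule sum_inverse_le_ln[OF T_pos])
  define V where "V \<omega> = (\<Sum>t=1..T. (norm (Er t \<omega>))\<^sup>2 / sqrt (real t))" for \<omega>
  have V_int: "integrable \<Omega> V"
    unfolding V_def[abs_def] using Er_int by (intro Bochner_Integration.integrable_sum) auto
  have V_eq: "(\<integral>\<omega>. V \<omega> \<partial>\<Omega>) = (\<Sum>t=1..T. e t / sqrt (real t))"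
    unfolding V_def e_def using Er_int by (subst Bochner_Integration.integral_sum) auto
  \<comment> \<open>In this pathwise bound only \<open>V\<close> is random; the 3 bounds the sum of
    squared step sizes.\<close>
  define R where "R \<omega> = f X1 - fstar + a * L * c\<^sup>2 / 2 * H
      + a / (2 * L) * V \<omega> + L / 2 * K\<^sup>2 * 3" for \<omega>
  have path: "\<kappa> * (\<Sum>t=1..T. \<eta> t * norm (gradf (X t \<omega>))) \<le> R \<omega>" if \<omega>: "\<omega> \<in> ?W" for \<omega>
  proof -
    have "\<kappa> * (\<eta> t * norm (gradf (X t \<omega>))) \<le> f (X t \<omega>) - f (X (Suc t) \<omega>)
        + a * L * c\<^sup>2 / 2 * (1 / real t) + a / (2 * L) * ((norm (Er t \<omega>))\<^sup>2 / sqrt (real t))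
        + L / 2 * K\<^sup>2 * (real t powr (-(3/4)))\<^sup>2" if "t \<in> {1..T}" for t
    proof -
      have t: "1 \<le> t" using that by simp
      have "a * (\<eta> t * c * norm (Er t \<omega>))
          \<le> a * ((L * c\<^sup>2 * (1 / real t) + (norm (Er t \<omega>))\<^sup>2 / sqrt (real t) / L) / 2)"
        unfolding \<eta>_eq[OF t] using young_stepsize[OF t L_pos] a by (intro mult_left_mono) auto
      then show ?thesis
        using step(2)[OF t \<omega>] \<eta>_eq[OF t] by (simp add: algebra_simps add_divide_distrib power_mult_distrib)
    qed
    then have "(\<Sum>t=1..T. \<kappa> * (\<eta> t * norm (gradf (X t \<omega>)))) \<le> (\<Sum>t=1..T. f (X t \<omega>) - f (X (Suc t) \<omega>)
        + a * L * c\<^sup>2 / 2 * (1 / real t) + a / (2 * L) * ((norm (Er t \<omega>))\<^sup>2 / sqrt (real t))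
        + L / 2 * K\<^sup>2 * (real t powr (-(3/4)))\<^sup>2)" by (rule sum_mono)
    also have "\<dots> = (\<Sum>t=1..T. f (X t \<omega>) - f (X (Suc t) \<omega>)) + a * L * c\<^sup>2 / 2 * H
        + a / (2 * L) * (\<Sum>t=1..T. (norm (Er t \<omega>))\<^sup>2 / sqrt (real t))
        + L / 2 * K\<^sup>2 * (\<Sum>t=1..T. (real t powr (-(3/4)))\<^sup>2)"
      unfolding H_def by (simp only: sum.distrib sum_distrib_left[symmetric])
    also have "(\<Sum>t=1..T. f (X t \<omega>) - f (X (Suc t) \<omega>)) = f (X 1 \<omega>) - f (X (Suc T) \<omega>)"
      using T_pos by (induction T rule: nat_induct_at_least) simp_all
    also have "f (X 1 \<omega>) - f (X (Suc T) \<omega>) \<le> f X1 - fstar" using X_init[OF \<omega>] f_bdd by (simp add: diff_mono)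
    also have "L / 2 * K\<^sup>2 * (\<Sum>t=1..T. (real t powr (-(3/4)))\<^sup>2) \<le> L / 2 * K\<^sup>2 * 3"
    proof (rule mult_left_mono)
      have "0 \<le> 2 / sqrt (real T)" by simp
      then show "(\<Sum>t=1..T. (real t powr (-(3/4)))\<^sup>2) \<le> 3"
        using sum_powr_three_halves_le[OF T_pos] by linarith
    qed (use L_pos in simp)
    finally show ?thesis by (simp add: R_def V_def sum_distrib_left)
  qed
  define b where "b t = (\<integral>\<omega>. norm (gradf (X t \<omega>)) \<partial>\<Omega>)" for t
  have b: "0 \<le> b t" for t by (simp add: b_def)
  have "\<kappa> * (\<Sum>t=1..T. \<eta> t * b t) = (\<integral>\<omega>. \<kappa> * (\<Sum>t=1..T. \<eta> t * norm (gradf (X t \<omega>))) \<partial>\<Omega>)"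
    using grad_int by (simp add: b_def Bochner_Integration.integral_sum)
  also have "\<dots> \<le> (\<integral>\<omega>. R \<omega> \<partial>\<Omega>)"
    using grad_int V_int path
    by (intro integral_mono) (auto simp: R_def intro!: Bochner_Integration.integrable_sum)
  also have "\<dots> = f X1 - fstar + a * L * c\<^sup>2 / 2 * H + a / (2 * L) * (\<Sum>t=1..T. e t / sqrt (real t)) + L / 2 * K\<^sup>2 * 3"
    unfolding V_eq[symmetric] using V_int by (simp add: R_def prob_space)
  also have "\<dots> \<le> f X1 - fstar + C1 * (1 + ln (real T)) + C2"
  proof -
    define h where "h = 1 + ln (real T)"
    have h: "0 \<le> h" using T_pos by (simp add: h_def)
    \<comment> \<open>The stated constants leave slack: the outer \<open>sqrt 2\<close> is rounded
      up to 2, \<open>sqrt 2 * P\<close> is doubled, and the factor 1/2 on the \<open>c^2\<close>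
      term is dropped.\<close>
    have s2: "sqrt 2 \<le> 2" using real_sqrt_le_mono[of 2 4] by simp
    have "a * L * c\<^sup>2 / 2 * H \<le> a * L * c\<^sup>2 / 2 * h"
      using H a L_pos by (intro mult_left_mono) (auto simp: h_def)
    also have "\<dots> \<le> a * L * c\<^sup>2 * h" using a L_pos h by simp
    finally have 1: "a * L * c\<^sup>2 / 2 * H \<le> a * L * c\<^sup>2 * h" .
    have "a / (2 * L) * (\<Sum>t=1..T. e t / sqrt (real t))
        \<le> a / (2 * L) * (sqrt 2 * (\<sigma>\<^sup>2 + (sqrt 2 * P + \<sigma>\<^sup>2) * h))"
      using e_sum a L_pos by (intro mult_left_mono) (auto simp: h_def)
    also have "\<dots> \<le> a / (2 * L) * (2 * (\<sigma>\<^sup>2 + (2 * sqrt 2 * P + \<sigma>\<^sup>2) * h))"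
      using s2 h P a L_pos
      by (intro mult_left_mono mult_mono add_mono mult_right_mono) (auto intro!: add_nonneg_nonneg)
    also have "\<dots> = a / L * (2 * sqrt 2 * P + \<sigma>\<^sup>2) * h + a * \<sigma>\<^sup>2 / L"
      using L_pos by (simp add: field_simps)
    finally have 2: "a / (2 * L) * (\<Sum>t=1..T. e t / sqrt (real t))
        \<le> a / L * (2 * sqrt 2 * P + \<sigma>\<^sup>2) * h + a * \<sigma>\<^sup>2 / L" .
    have "C1 = a / L * (2 * sqrt 2 * P + \<sigma>\<^sup>2) + a * L * c\<^sup>2" "C2 = a * \<sigma>\<^sup>2 / L + 3 * L / 2 * K\<^sup>2"
      by (simp_all add: C1_eq C2_eq P_def K_def c_def n_def m_def)
    then show ?thesis using 1 2 unfolding h_def[symmetric] by (simp add: algebra_simps)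
  qed
  finally have main: "\<kappa> * (\<Sum>t=1..T. \<eta> t * b t) \<le> f X1 - fstar + C1 * (1 + ln (real T)) + C2" (is "_ \<le> ?R") .
  obtain x where x: "0 < x" "real T = x ^ 4" "real T powr (-(3/4)) = 1 / x ^ 3" "real T powr (1/4) = x"
    using obtain_root4[OF T_pos] by metis
  \<comment> \<open>Step sizes decrease, so each is at least \<open>1 / x^3\<close>, the last one. A
    further factor \<open>1 / x\<close> turns this into the average over \<open>T = x^4\<close>
    terms.\<close>
  have "(\<Sum>t=1..T. 1 / x ^ 3 * b t) \<le> (\<Sum>t=1..T. \<eta> t * b t)"
  proof (intro sum_mono mult_right_mono b)
    fix t assume "t \<in> {1..T}"
    then show "1 / x ^ 3 \<le> \<eta> t"
      using powr_mono2'[of "-(3/4)" "real t" "real T"] by (simp add: \<eta>_eq x(3)[symmetric])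
  qed
  then have "\<kappa> * (1 / x ^ 3 * (\<Sum>t=1..T. b t)) \<le> ?R"
    using main mult_left_mono[of _ _ \<kappa>] \<kappa> by (fastforce simp: sum_distrib_left)
  then have "1 / x ^ 4 * (\<Sum>t=1..T. b t) \<le> ?R / (\<kappa> * x)"
    using \<kappa> x(1) by (simp add: field_simps power3_eq_cube power4_eq_xxxx)
  then have "1 / real T * (\<Sum>t=1..T. b t) \<le> ?R / (\<kappa> * real T powr (1/4))"
    unfolding x(4) unfolding x(2)[symmetric] .
  then show ?thesis using grad_int by (simp add: b_def \<kappa>_def m_def)
qed

end
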